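(* Consider a delayed scale-free adversarial multi-armed bandit in which all losses are non-negative, i.e. $l_t\in[0,L]^K$ for all $t$, where the finite bound $L$ is unknown to the agent. The algorithm Banker-SFTINF ensures $$\mathfrak R_T=O\left(\sqrt{K(D+T)\log(D+T)}\cdot L\right)=\tilde O\left(\sqrt{K(D+T)}\,L\right),$$ where $\tilde O(\cdot)$ ignores all logarithmic factors.
   Context: **Notation.** $\triangle^{[K]}$ is the probability simplex in $\mathbb R^K$; $\mathbf 1_i$ is the $i$-th standard basis vector. $f^*(y)=\sup_x\{\langle y,x\rangle-f(x)\}$ is the Fenchel conjugate, and $\bar f$ is the restriction of $f$ to $\triangle^{[K]}$ ($\bar f=f$ on $\triangle^{[K]}$, $+\infty$ elsewhere). **Setting.** There are $K\ge2$ arms and $T\ge1$ rounds. An oblivious adversary fixes loss vectors $l_t$ and delays $d_t\in\{0,1,2,\dots\}$, hidden from the agent; $D=\sum_{t=1}^Td_t$. In round $t$ the agent picks $A_t\in[K]$; the feedback $(t,l_{t,A_t})$ is revealed at the end of round $t+d_t$. The pseudo-regret is $\mathfrak R_T=\max_{i\in[K]}\mathbb E[\sum_{t=1}^Tl_{t,A_t}-\sum_{t=1}^Tl_{t,i}]$. **Banker-SFTINF.** Let $\Psi(x)=-2\sum_{i=1}^K\sqrt{x_i}$ on $\mathbb R_+^K$, $x_0=(1/K,\dots,1/K)$, $\hat L_1=1$. Each round $s$ carries a status $a_s\in\{\text{missing},\text{arrived},\text{skipped}\}$. In round $t=1,\dots,T$: (i) set $a_t\leftarrow$ missing, let $\mathfrak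 d_t=\#\{s<t: a_s=\text{missing}\}$, let $D_t=\sum_{s=1}^t(\mathfrak d_s+1)\hat L_s^2$ and $$\sigma_t=\left((\mathfrak d_t+1)\sqrt{\frac{\ln(3+D_t/\hat L_t^2)}{3+D_t}}\right)^{-1};$$ set $v_t\leftarrow\sigma_t$; (ii) set $b_t\leftarrow\sigma_t$; successively for every $s<t$ with $a_s=\text{arrived}$, set $\sigma_{t,s}=\min\{v_s,b_t\}$ and $b_t\leftarrow b_t-\sigma_{t,s}$; for all other $s<t$, $\sigma_{t,s}=0$; then $v_s\leftarrow v_s-\sigma_{t,s}$ for all $s<t$; (iii) set $x_t=\nabla\bar\Psi^*\bigl(\frac1{\sigma_t}\sum_{s<t}\sigma_{t,s}\nabla\Psi(z_s)+\frac{b_t}{\sigma_t}\nabla\Psi(x_0)\bigr)$, and sample and play $A_t\sim x_t$; (iv) initialize $\hat L_{t+1}\leftarrow\hat L_t$, and for each new feedback $(s,l_{s,A_s})$ received: set $\hat L_{t+1}\leftarrow\max\{\hat L_{t+1},2l_{s,A_s}\}$; if $l_{s,A_s}>\hat L_s$, set $\tilde l_s=\mathbf 0$ and $a_s\leftarrow$ skipped; otherwise set $\tilde l_s=\frac{l_{s,A_s}}{x_{s,A_s}}\mathbf 1_{A_s}$ and $a_s\leftarrow$ arrived; then set $z_s=\nabla\bar\Psi^*(\nabla\Psi(x_s)-\frac1{\sigma_s}\tilde l_s)$.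
   Formalization: The O-constant is uniform in K, T, losses, delays and all L ≥ L0 (any fixed L0 > 0, constant depending on L0) or L = 0, as uniformity for L → 0 fails because the algorithm starts from the guess 1; and D+T ≥ 2 is required since log(D+T) = 0 at D+T = 1. *)

theory Defs
  imports "HOL-Probability.Probability"
begin

text \<open>
  The number of arms is quantified inside the main statement (the constant hidden in the
  O-notation does not depend on it), so a vector of dimension \<open>K\<close> is a function
  \<open>nat \<Rightarrow> real\<close> that vanishes outside \<open>{1..K}\<close>.
\<close>

type_synonym rvec = "nat \<Rightarrow> real"

definition vecs :: "nat \<Rightarrow> rvec set" where
  "vecs K = {x. \<forall>i. i \<notin> {1..K} \<longrightarrow> x i = 0}"

definition prob_simplex :: "nat \<Rightarrow> rvec set" where
  "prob_simplex K = {x \<in> vecs K. (\<forall>i\<in>{1..K}. 0 \<le> x i) \<and> (\<Sum>i=1..K. x i) = 1}"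

text \<open>The gradient as the vector of partial derivatives.\<close>

definition grad :: "nat \<Rightarrow> (rvec \<Rightarrow> real) \<Rightarrow> rvec \<Rightarrow> rvec" where
  "grad K f y = (\<lambda>i. if i \<in> {1..K} then deriv (\<lambda>h. f (y(i := h))) (y i) else 0)"

definition fenchel :: "nat \<Rightarrow> (rvec \<Rightarrow> ereal) \<Rightarrow> rvec \<Rightarrow> ereal" where
  "fenchel K f y = (SUP x\<in>vecs K. ereal (\<Sum>i=1..K. y i * x i) - f x)"

definition simplex_restriction :: "nat \<Rightarrow> (rvec \<Rightarrow> real) \<Rightarrow> rvec \<Rightarrow> ereal" where
  "simplex_restriction K f x = (if x \<in> prob_simplex K then ereal (f x) else \<infinity>)"

text \<open>The gradient of the Fenchel conjugate of the restriction of \<open>f\<close> to the simplex.\<close>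

definition grad_conj :: "nat \<Rightarrow> (rvec \<Rightarrow> real) \<Rightarrow> rvec \<Rightarrow> rvec" where
  "grad_conj K f = grad K (\<lambda>y. real_of_ereal (fenchel K (simplex_restriction K f) y))"

definition Psi :: "nat \<Rightarrow> rvec \<Rightarrow> real" where
  "Psi K x = - 2 * (\<Sum>i=1..K. sqrt (x i))"

definition uniform_vec :: "nat \<Rightarrow> rvec" where
  "uniform_vec K = (\<lambda>i. if i \<in> {1..K} then 1 / real K else 0)"

datatype status = Missing | Arrived | Skipped

text \<open>
  Withdrawals in one round: accounts \<open>s = 1, 2, \<dots>\<close> satisfying \<open>P\<close> are visited in increasing
  order, \<open>v s\<close> is the balance of account \<open>s\<close>, \<open>b\<close> the initial demand, and
  \<open>demand P v b s\<close> the demand that remains after accounts \<open>1, \<dots>, s\<close> have been visited.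
\<close>

primrec demand :: "(nat \<Rightarrow> bool) \<Rightarrow> (nat \<Rightarrow> real) \<Rightarrow> real \<Rightarrow> nat \<Rightarrow> real" where
  "demand P v b 0 = b"
| "demand P v b (Suc s) =
     demand P v b s - (if P (Suc s) then min (v (Suc s)) (demand P v b s) else 0)"

definition withdrawal :: "(nat \<Rightarrow> bool) \<Rightarrow> (nat \<Rightarrow> real) \<Rightarrow> real \<Rightarrow> nat \<Rightarrow> real" where
  "withdrawal P v b s = (if P s then min (v s) (demand P v b (s - 1)) else 0)"

text \<open>
  The internal variables of Banker-SFTINF as functions of the loss vectors \<open>l\<close>, the delays
  \<open>d\<close> and the sequence \<open>A\<close> of played arms. Rounds are numbered from 1; the values at round 0
  are dummies. The quantities belonging to round \<open>t\<close> (up to the choice of the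
  distribution \<open>play_dist t\<close>) only use \<open>A s\<close> and \<open>l s (A s)\<close> for rounds \<open>s\<close> with
  \<open>s + d s < t\<close>, i.e. feedback revealed before round \<open>t\<close>.
\<close>

context
  fixes K :: nat and l :: "nat \<Rightarrow> nat \<Rightarrow> real" and d :: "nat \<Rightarrow> nat" and A :: "nat \<Rightarrow> nat"
begin

primrec Lhat :: "nat \<Rightarrow> real" where
  "Lhat 0 = 1"
| "Lhat (Suc t) = Max (insert (Lhat t) {2 * l s (A s) |s. s \<in> {1..t} \<and> s + d s = t})"

text \<open>
  The status of round \<open>s\<close> at the beginning of round \<open>t > s\<close>; the feedback of \<open>s\<close> is
  revealed at the end of round \<open>s + d s\<close>.
\<close>

definition round_status :: "nat \<Rightarrow> nat \<Rightarrow> status" where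
  "round_status t s =
     (if t \<le> s + d s then Missing
      else if l s (A s) > Lhat s then Skipped else Arrived)"

definition num_missing :: "nat \<Rightarrow> nat" where
  "num_missing t = card {s \<in> {1..<t}. round_status t s = Missing}"

definition cumD :: "nat \<Rightarrow> real" where
  "cumD t = (\<Sum>s=1..t. (real (num_missing s) + 1) * (Lhat s)\<^sup>2)"

definition sigma :: "nat \<Rightarrow> real" where
  "sigma t = inverse ((real (num_missing t) + 1) *
                      sqrt (ln (3 + cumD t / (Lhat t)\<^sup>2) / (3 + cumD t)))"

definition usable :: "nat \<Rightarrow> nat \<Rightarrow> bool" where
  "usable t s \<longleftrightarrow> s \<in> {1..<t} \<and> round_status t s = Arrived"

text \<open>\<open>vault t s\<close> is the value of the variable \<open>v\<^sub>s\<close> at the end of round \<open>t\<close>.\<close>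

primrec vault :: "nat \<Rightarrow> nat \<Rightarrow> real" where
  "vault 0 = (\<lambda>s. 0)"
| "vault (Suc t) = (\<lambda>s. if s = Suc t then sigma (Suc t)
     else vault t s - withdrawal (usable (Suc t)) (vault t) (sigma (Suc t)) s)"

definition sigma2 :: "nat \<Rightarrow> nat \<Rightarrow> real" where
  "sigma2 t s = withdrawal (usable t) (vault (t - 1)) (sigma t) s"

text \<open>The demand \<open>b\<^sub>t\<close> left after all withdrawals of round \<open>t\<close>.\<close>

definition invest :: "nat \<Rightarrow> real" where
  "invest t = demand (usable t) (vault (t - 1)) (sigma t) (t - 1)"

definition loss_est :: "nat \<Rightarrow> rvec \<Rightarrow> rvec" where
  "loss_est s x = (\<lambda>i. if l s (A s) > Lhat s then 0
                       else if i = A s then l s (A s) / x (A s) else 0)"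

definition post_dist :: "nat \<Rightarrow> rvec \<Rightarrow> rvec" where
  "post_dist s x =
     grad_conj K (Psi K) (\<lambda>i. grad K (Psi K) x i - 1 / sigma s * loss_est s x i)"

text \<open>
  \<open>play_dist t\<close> is \<open>x\<^sub>t\<close>, and \<open>post_dist s (play_dist s)\<close> is \<open>z\<^sub>s\<close>. The latter is only
  used for rounds with status \<open>Arrived\<close>, since \<open>sigma2 t s = 0\<close> for all the others.
\<close>

fun play_dist :: "nat \<Rightarrow> rvec" where
  "play_dist t = grad_conj K (Psi K) (\<lambda>i.
     1 / sigma t * (\<Sum>s\<in>{1..<t}. sigma2 t s * grad K (Psi K) (post_dist s (play_dist s)) i)
     + invest t / sigma t * grad K (Psi K) (uniform_vec K) i)"

declare play_dist.simps [simp del]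

end

text \<open>
  The joint law of the arms played in rounds \<open>1, \<dots>, t\<close>: given the past, the arm of round
  \<open>t\<close> is drawn from \<open>play_dist t\<close>. Entries of rounds not yet played are the dummy \<open>0\<close>.
\<close>

primrec actions :: "nat \<Rightarrow> (nat \<Rightarrow> nat \<Rightarrow> real) \<Rightarrow> (nat \<Rightarrow> nat) \<Rightarrow> nat \<Rightarrow> (nat \<Rightarrow> nat) pmf" where
  "actions K l d 0 = return_pmf (\<lambda>_. 0)"
| "actions K l d (Suc t) = bind_pmf (actions K l d t)
     (\<lambda>A. map_pmf (\<lambda>i. A(Suc t := i)) (embed_pmf (play_dist K l d A (Suc t))))"

definition pseudo_regret :: "nat \<Rightarrow> (nat \<Rightarrow> nat \<Rightarrow> real) \<Rightarrow> (nat \<Rightarrow> nat) \<Rightarrow> nat \<Rightarrow> real" where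
  "pseudo_regret K l d T = (MAX i\<in>{1..K}.
     measure_pmf.expectation (actions K l d T)
       (\<lambda>A. (\<Sum>t=1..T. l t (A t)) - (\<Sum>t=1..T. l t i)))"

definition total_delay :: "(nat \<Rightarrow> nat) \<Rightarrow> nat \<Rightarrow> nat" where
  "total_delay d T = (\<Sum>t=1..T. d t)"

text \<open>
  Losses are admissible for the range \<open>L\<close> if they lie in \<open>[0, L]\<close> during all \<open>T\<close> rounds.
  The algorithm starts with the absolute guess \<open>Lhat 1 = 1\<close> for the range, so its regret is not
  homogeneous in \<open>L\<close>: for \<open>K = 2\<close>, no delays, and constant losses \<open>(0, L)\<close>, regret divided by
  \<open>L\<close> tends to \<open>T / 2\<close> as \<open>L\<close> tends to 0. Hence a constant hidden in an O-bound that is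
  linear in \<open>L\<close> can be uniform in \<open>L\<close> only as long as \<open>L\<close> stays away from 0 (or equals 0).
\<close>

definition losses_in :: "nat \<Rightarrow> nat \<Rightarrow> real \<Rightarrow> (nat \<Rightarrow> nat \<Rightarrow> real) \<Rightarrow> bool" where
  "losses_in K T L l \<longleftrightarrow> (\<forall>t\<in>{1..T}. \<forall>i\<in>{1..K}. 0 \<le> l t i \<and> l t i \<le> L)"

end

(*
  The rule x_t = grad conj(Psi)(...) makes x_t a Bregman barycenter of x_0 and the points z_s, so
  sigma_t D(y, x_t) <= sum_s sigma_{t,s} D(y, z_s) + b_t D(y, x_0), while the mirror step gives
  <l~_t, x_t - y> = sigma_t (D(y, x_t) - D(y, z_t) + D(x_t, z_t)).  With the vault balances as weights
  of a potential sum_s v_s D(y, z_s), the linearized regret is at most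
  (sum_t b_t) D(y, x_0) + sum_t sigma_t D(x_t, z_t), where D(e_k, x_0) <= 2 sqrt K.

  The vault balances sum up to the total investment, and whenever b_t > 0 all usable vaults are empty;
  hence sum_t b_t is bounded by the sigma_s of rounds that are pending at one common time or skipped.
  The j-th of several simultaneously pending rounds sees at least j - 1 missing feedbacks, so their
  sigma_s sum up like 1 / (j sqrt (ln j)), i.e. to the square root of a logarithm. Skipped rounds
  whose losses agree up to a factor 2 are simultaneously pending, and summing over dyadic levels
  costs only a constant factor.

  For losses not exceeding Lhat_t, the stability term has conditional expectation at most
  sqrt K Lhat_t^2 / sigma_t, and these terms telescope through the square root of D_t.
*)
theory Submission
  imports Defs
begin

section \<open>The gradient map of the restricted Tsallis entropy\<close>

definition pos_simplex :: "nat \<Rightarrow> rvec set" where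
  "pos_simplex K = {x \<in> prob_simplex K. \<forall>i\<in>{1..K}. 0 < x i}"

text \<open>The Bregman divergence of \<open>Psi\<close> from \<open>x\<close> to \<open>y\<close>,
  completed to a square: nonnegativity is visible and \<open>y\<close> may lie on the boundary of
  the simplex.\<close>

definition breg :: "nat \<Rightarrow> rvec \<Rightarrow> rvec \<Rightarrow> real" where
  "breg K y x = (\<Sum>i=1..K. (sqrt (y i) - sqrt (x i))\<^sup>2 / sqrt (x i))"

text \<open>Maximizing \<open>\<langle>y, x\<rangle> - \<Psi>(x)\<close> over the simplex with a Lagrange multiplier \<open>c\<close> for the constraint
  \<open>\<Sum>x\<^sub>i = 1\<close> gives \<open>y\<^sub>i + 1 / sqrt x\<^sub>i = c\<close>.\<close>

definition multiplier :: "nat \<Rightarrow> rvec \<Rightarrow> real \<Rightarrow> bool" where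
  "multiplier K y c \<longleftrightarrow> (\<forall>i\<in>{1..K}. y i < c) \<and> (\<Sum>i=1..K. 1 / (c - y i)\<^sup>2) = 1"

definition dual_point :: "nat \<Rightarrow> rvec \<Rightarrow> real \<Rightarrow> rvec" where
  "dual_point K y c = (\<lambda>i. if i \<in> {1..K} then 1 / (c - y i)\<^sup>2 else 0)"

lemma breg_nonneg: "x \<in> prob_simplex K \<Longrightarrow> 0 \<le> breg K y x"
  unfolding breg_def prob_simplex_def by (intro sum_nonneg) auto

text \<open>Expanding the square recovers the usual form of the divergence,
  \<open>- 1 / sqrt (x i)\<close> being the partial derivative of \<open>Psi\<close> at
  \<open>x\<close>.\<close>

lemma breg_alt:
  assumes "x \<in> pos_simplex K" "y \<in> prob_simplex K"
  shows "breg K y x = Psi K y - Psi K x + (\<Sum>i=1..K. (y i - x i) / sqrt (x i))"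
proof -
  have "(sqrt (y i) - sqrt (x i))\<^sup>2 / sqrt (x i)
      = - 2 * sqrt (y i) + 2 * sqrt (x i) + (y i - x i) / sqrt (x i)" if "i \<in> {1..K}" for i
  proof -
    have p: "0 < x i" "0 \<le> y i" using assms that by (auto simp: pos_simplex_def prob_simplex_def)
    have "(sqrt (y i) - sqrt (x i))\<^sup>2 = y i - 2 * sqrt (y i) * sqrt (x i) + x i"
      using p by (simp add: power2_diff)
    moreover have "x i = sqrt (x i) * sqrt (x i)" using p by simp
    ultimately show ?thesis using p by (simp add: field_simps)
  qed
  then show ?thesis
    unfolding breg_def Psi_def
    by (simp add: sum.distrib sum_subtractf sum_distrib_left sum_negf)
qed

lemma grad_Psi:
  assumes "i \<in> {1..K}" "0 < x i"
  shows "grad K (Psi K) x i = - 1 / sqrt (x i)"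
proof -
  have "((\<lambda>h. Psi K (x(i := h))) has_real_derivative - 1 / sqrt (x i)) (at (x i))"
  proof -
    have *: "Psi K (x(i := h)) = - 2 * (sqrt h + (\<Sum>j\<in>{1..K} - {i}. sqrt (x j)))" for h
    proof -
      have "(\<Sum>j=1..K. sqrt ((x(i := h)) j)) = sqrt h + (\<Sum>j\<in>{1..K} - {i}. sqrt ((x(i := h)) j))"
        by (subst sum.remove[OF _ assms(1)]) simp_all
      then show ?thesis by (simp add: Psi_def)
    qed
    show ?thesis unfolding *
      using assms(2) by (auto intro!: derivative_eq_intros simp: field_simps)
  qed
  then show ?thesis using assms(1) by (simp add: grad_def DERIV_imp_deriv)
qed

text \<open>Intermediate value theorem between \<open>M + 1\<close>, where the largest coordinate
  alone contributes 1, and \<open>M + sqrt K\<close>, where each of the \<open>K\<close> terms is at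
  most \<open>1 / K\<close>.\<close>

lemma multiplier_exists:
  assumes "1 \<le> K"
  obtains c where "multiplier K y c"
proof -
  define M where "M = Max (y ` {1..K})"
  have fin: "finite (y ` {1..K})" "y ` {1..K} \<noteq> {}" using assms by auto
  have le: "y i \<le> M" if "i \<in> {1..K}" for i using that by (simp add: M_def)
  obtain m where m: "m \<in> {1..K}" "y m = M" using Max_in[OF fin] by (auto simp: M_def)
  let ?g = "\<lambda>c. \<Sum>i=1..K. 1 / (c - y i)\<^sup>2"
  have sK: "1 \<le> sqrt (real K)" using assms by simp
  have "\<exists>c. M + 1 \<le> c \<and> c \<le> M + sqrt (real K) \<and> ?g c = 1"
  proof (rule IVT2')
    have "1 = 1 / (M + 1 - y m)\<^sup>2" using m by simp
    also have "\<dots> \<le> ?g (M + 1)" using m(1) by (intro member_le_sum) auto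
    finally show "1 \<le> ?g (M + 1)" .
    have "?g (M + sqrt (real K)) \<le> (\<Sum>i=1..K. 1 / real K)"
    proof (intro sum_mono)
      fix i assume i: "i \<in> {1..K}"
      have "(sqrt (real K))\<^sup>2 \<le> (M + sqrt (real K) - y i)\<^sup>2"
        using le[OF i] sK by (intro power_mono) auto
      then show "1 / (M + sqrt (real K) - y i)\<^sup>2 \<le> 1 / real K"
        using assms by (intro divide_left_mono) (auto intro: mult_pos_pos less_le_trans[of 0 "real K"])
    qed
    then show "?g (M + sqrt (real K)) \<le> 1" using assms by simp
    show "M + 1 \<le> M + sqrt (real K)" using sK by simp
    show "continuous_on {M + 1..M + sqrt (real K)} ?g"
    proof (intro continuous_intros ballI)
      fix i c assume "i \<in> {1..K}" "c \<in> {M + 1..M + sqrt (real K)}"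
      then show "(c - y i)\<^sup>2 \<noteq> 0" using le[of i] by auto
    qed
  qed
  then obtain c where "M + 1 \<le> c" "?g c = 1" by blast
  then have "multiplier K y c" using le by (force simp: multiplier_def)
  then show ?thesis by (rule that)
qed

text \<open>If \<open>c'\<close> exceeded \<open>c + e\<close>, every term with \<open>c'\<close>
  would be strictly smaller than its counterpart, and the two sums could not both be 1. The case
  \<open>e = 0\<close> gives uniqueness, general \<open>e\<close> the Lipschitz bound in
  \<open>y\<close>.\<close>

lemma multiplier_le:
  assumes "1 \<le> K" "multiplier K y c" "multiplier K y' c'"
    and le: "\<And>i. i \<in> {1..K} \<Longrightarrow> y' i \<le> y i + e"
  shows "c' \<le> c + e"
proof (rule ccontr)
  assume *: "\<not> c' \<le> c + e"
  have "(\<Sum>i=1..K. 1 / (c' - y' i)\<^sup>2) < (\<Sum>i=1..K. 1 / (c - y i)\<^sup>2)"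
  proof (intro sum_strict_mono)
    fix i assume i: "i \<in> {1..K}"
    have "0 < c - y i" using assms(2) i by (auto simp: multiplier_def)
    moreover have "c - y i < c' - y' i" using le[OF i] * by linarith
    ultimately have "0 < (c - y i)\<^sup>2" "(c - y i)\<^sup>2 < (c' - y' i)\<^sup>2"
      by (auto intro: power_strict_mono)
    then show "1 / (c' - y' i)\<^sup>2 < 1 / (c - y i)\<^sup>2"
      by (intro divide_strict_left_mono mult_pos_pos) (auto intro: less_trans)
  qed (use assms(1) in auto)
  then show False using assms(2,3) by (simp add: multiplier_def)
qed

lemma dual_point_pos_simplex: "multiplier K y c \<Longrightarrow> dual_point K y c \<in> pos_simplex K"
  unfolding multiplier_def dual_point_def pos_simplex_def prob_simplex_def vecs_def
  by auto

lemma dual_point_sqrt: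
  assumes "multiplier K y c" "i \<in> {1..K}"
  shows "1 / sqrt (dual_point K y c i) = c - y i"
proof -
  have "0 < c - y i" using assms by (auto simp: multiplier_def)
  then show ?thesis using assms(2) by (simp add: dual_point_def real_sqrt_divide)
qed

text \<open>The gap to the maximum is exactly a Bregman divergence: the multiplier \<open>c\<close>
  only meets the difference of total masses, which is 0 on the simplex.\<close>

lemma fenchel_maximizer:
  assumes "multiplier K y c" "w \<in> prob_simplex K"
  defines "x \<equiv> dual_point K y c"
  shows "(\<Sum>i=1..K. y i * w i) - Psi K w = (\<Sum>i=1..K. y i * x i) - Psi K x - breg K w x"
proof -
  have x: "x \<in> pos_simplex K" unfolding x_def by (rule dual_point_pos_simplex[OF assms(1)])
  have "(\<Sum>i=1..K. (w i - x i) / sqrt (x i)) = (\<Sum>i=1..K. (w i - x i) * (c - y i))"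
    using dual_point_sqrt[OF assms(1)] by (intro sum.cong) (auto simp: x_def divide_inverse)
  also have "\<dots> = c * ((\<Sum>i=1..K. w i) - (\<Sum>i=1..K. x i)) - (\<Sum>i=1..K. y i * w i) + (\<Sum>i=1..K. y i * x i)"
    by (simp add: algebra_simps sum_subtractf sum.distrib sum_distrib_left)
  also have "(\<Sum>i=1..K. w i) - (\<Sum>i=1..K. x i) = 0"
    using x assms(2) by (simp add: pos_simplex_def prob_simplex_def)
  finally show ?thesis unfolding breg_alt[OF x assms(2)] by simp
qed

lemma fenchel_Psi:
  assumes "multiplier K y c"
  shows "fenchel K (simplex_restriction K (Psi K)) y =
    ereal ((\<Sum>i=1..K. y i * dual_point K y c i) - Psi K (dual_point K y c))"
  unfolding fenchel_def
proof (rule SUP_eqI)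
  have x: "dual_point K y c \<in> prob_simplex K"
    using dual_point_pos_simplex[OF assms] by (simp add: pos_simplex_def)
  fix w assume "w \<in> vecs K"
  show "ereal (\<Sum>i=1..K. y i * w i) - simplex_restriction K (Psi K) w
     \<le> ereal ((\<Sum>i=1..K. y i * dual_point K y c i) - Psi K (dual_point K y c))"
    using fenchel_maximizer[OF assms, of w] breg_nonneg[OF x, of w]
    by (auto simp: simplex_restriction_def)
next
  fix u
  assume u: "\<And>w. w \<in> vecs K \<Longrightarrow> ereal (\<Sum>i=1..K. y i * w i) - simplex_restriction K (Psi K) w \<le> u"
  have "dual_point K y c \<in> prob_simplex K" "dual_point K y c \<in> vecs K"
    using dual_point_pos_simplex[OF assms] by (auto simp: pos_simplex_def prob_simplex_def)
  then show "ereal ((\<Sum>i=1..K. y i * dual_point K y c i) - Psi K (dual_point K y c)) \<le> u"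
    using u[of "dual_point K y c"] by (simp add: simplex_restriction_def)
qed

text \<open>Danskin's argument: the difference quotients of the conjugate lie between the coordinates of the
  maximizers at the two end points, and the multiplier is 1-Lipschitz in \<open>y\<close>.\<close>

lemma grad_conj_eq_dual_point:
  assumes K: "1 \<le> K" and c: "multiplier K y c"
  shows "grad_conj K (Psi K) y = dual_point K y c"
proof
  fix i
  show "grad_conj K (Psi K) y i = dual_point K y c i"
  proof (cases "i \<in> {1..K}")
    case True
    define f where "f h = real_of_ereal (fenchel K (simplex_restriction K (Psi K)) (y(i := h)))" for h
    define x where "x = dual_point K y c"
    have "\<exists>m. multiplier K (y(i := h)) m" for h using multiplier_exists[OF K] by metis
    then obtain m where m: "\<And>h. multiplier K (y(i := h)) (m h)" by metis
    define X where "X h = dual_point K (y(i := h)) (m h)" for h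
    have m0: "m (y i) = c"
      using multiplier_le[OF K c m[of "y i"], of 0] multiplier_le[OF K m[of "y i"] c, of 0] by auto
    have dm: "\<bar>m h - c\<bar> \<le> \<bar>h - y i\<bar>" for h
      using multiplier_le[OF K c m[of h], of "\<bar>h - y i\<bar>"]
        multiplier_le[OF K m[of h] c, of "\<bar>h - y i\<bar>"] by fastforce
    have "((\<lambda>h. m h - c) \<longlongrightarrow> 0) (at (y i))"
    proof (rule Lim_null_comparison)
      show "\<forall>\<^sub>F h in at (y i). norm (m h - c) \<le> \<bar>h - y i\<bar>" using dm by simp
      show "((\<lambda>h. \<bar>h - y i\<bar>) \<longlongrightarrow> 0) (at (y i))" by (auto intro!: tendsto_eq_intros)
    qed
    then have mt: "(m \<longlongrightarrow> c) (at (y i))" by (simp add: LIM_zero_iff)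
    have ci: "y i < c" using c True by (auto simp: multiplier_def)
    have Xt: "((\<lambda>h. X h i) \<longlongrightarrow> x i) (at (y i))"
      unfolding X_def x_def dual_point_def using True ci
      by (auto intro!: tendsto_eq_intros mt)
    have val: "f h = (\<Sum>j=1..K. (y(i := h)) j * X h j) - Psi K (X h)" for h
      using fenchel_Psi[OF m[of h]] by (simp add: f_def X_def)
    have lower: "(\<Sum>j=1..K. (y(i := h)) j * w j) - Psi K w \<le> f h" if "w \<in> prob_simplex K" for h w
    proof -
      have "X h \<in> prob_simplex K"
        using dual_point_pos_simplex[OF m] by (simp add: X_def pos_simplex_def)
      from breg_nonneg[OF this, of w] show ?thesis
        using fenchel_maximizer[OF m[of h] that] unfolding val X_def by linarith
    qed
    have shift: "(\<Sum>j=1..K. (y(i := h)) j * w j) = (\<Sum>j=1..K. (y(i := h')) j * w j) + (h - h') * w i" for h h' w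
    proof -
      have *: "(\<Sum>j=1..K. (y(i := h)) j * w j) = h * w i + (\<Sum>j\<in>{1..K}-{i}. y j * w j)" for h
        using True by (simp add: sum.remove[of _ i])
      show ?thesis unfolding * by (simp add: algebra_simps)
    qed
    have X0: "X (y i) = x" by (simp add: X_def x_def m0)
    have Xs: "X h \<in> prob_simplex K" for h
      using dual_point_pos_simplex[OF m] by (simp add: X_def pos_simplex_def)
    \<comment> \<open>The maximizer at \<open>y i\<close> is a competitor at \<open>h\<close>, and
      conversely; this sandwiches the increment of \<open>f\<close>.\<close>
    have b1: "x i * (h - y i) \<le> f h - f (y i)" for h
      using lower[OF Xs[of "y i"], of h] shift[of h "X (y i)" "y i"] unfolding val[of "y i"] X0
      by (simp add: mult.commute)
    have b2: "f h - f (y i) \<le> X h i * (h - y i)" for h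
      using lower[OF Xs[of h], of "y i"] shift[of h "X h" "y i"] unfolding val[of h]
      by (simp add: mult.commute)
    have "((\<lambda>h. (f h - f (y i)) / (h - y i) - x i) \<longlongrightarrow> 0) (at (y i))"
    proof (rule Lim_null_comparison)
      have "\<bar>(f h - f (y i)) / (h - y i) - x i\<bar> \<le> \<bar>X h i - x i\<bar>" if "h \<noteq> y i" for h
      proof (cases "y i < h")
        case True
        then have "x i \<le> (f h - f (y i)) / (h - y i)" "(f h - f (y i)) / (h - y i) \<le> X h i"
          using b1[of h] b2[of h] by (simp_all add: pos_le_divide_eq pos_divide_le_eq)
        then show ?thesis by simp
      next
        case False
        then have "h - y i < 0" using that by simp
        then have "X h i \<le> (f h - f (y i)) / (h - y i)" "(f h - f (y i)) / (h - y i) \<le> x i"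
          using b1[of h] b2[of h] by (simp_all add: neg_le_divide_eq neg_divide_le_eq)
        then show ?thesis by simp
      qed
      then show "\<forall>\<^sub>F h in at (y i). norm ((f h - f (y i)) / (h - y i) - x i) \<le> \<bar>X h i - x i\<bar>"
        by (auto simp: eventually_at_filter)
      show "((\<lambda>h. \<bar>X h i - x i\<bar>) \<longlongrightarrow> 0) (at (y i))"
        using Xt by (auto intro!: tendsto_eq_intros)
    qed
    then have "(f has_real_derivative x i) (at (y i))"
      by (simp add: has_field_derivative_iff LIM_zero_iff)
    then show ?thesis
      using True by (simp add: grad_conj_def grad_def DERIV_imp_deriv f_def[symmetric] x_def)
  next
    case False
    then show ?thesis by (auto simp: grad_conj_def grad_def dual_point_def)
  qed
qed

lemma grad_conj_Psi_pos_simplex: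
  assumes "1 \<le> K"
  shows "grad_conj K (Psi K) y \<in> pos_simplex K"
  using multiplier_exists[OF assms] grad_conj_eq_dual_point[OF assms] dual_point_pos_simplex by metis

text \<open>Apart from positivity, this is all that later arguments use about the gradient map.
  Since \<open>c\<close> is the same for all arms, it vanishes when tested against a difference of
  two simplex points.\<close>

lemma grad_conj_Psi_stationary:
  assumes "1 \<le> K"
  shows "\<exists>c. \<forall>i\<in>{1..K}. 1 / sqrt (grad_conj K (Psi K) y i) = c - y i"
  using multiplier_exists[OF assms] grad_conj_eq_dual_point[OF assms] dual_point_sqrt by metis

section \<open>Withdrawals and the total investment\<close>

lemma demand_bounds:
  assumes "0 \<le> b" "\<And>s. 0 \<le> v s"
  shows "0 \<le> demand P v b s" "demand P v b s \<le> b"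
proof -
  have "0 \<le> demand P v b s \<and> demand P v b s \<le> b"
  proof (induction s)
    case (Suc s)
    then show ?case using assms(2)[of "Suc s"] by (auto simp: min_def)
  qed (use assms(1) in simp)
  then show "0 \<le> demand P v b s" "demand P v b s \<le> b" by auto
qed

lemma sum_withdrawal: "(\<Sum>s=1..n. withdrawal P v b s) = b - demand P v b n"
  by (induction n) (auto simp: withdrawal_def)

lemma withdrawal_bounds:
  assumes "0 \<le> b" "\<And>s. 0 \<le> v s"
  shows "0 \<le> withdrawal P v b s" "withdrawal P v b s \<le> v s"
  using demand_bounds[OF assms, of P] assms by (auto simp: withdrawal_def)

text \<open>A positive final demand was positive at every earlier account, since it never recovers
  from 0; so at each usable account the minimum was the balance and not the demand.\<close>

lemma demand_positive_imp_emptied: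
  assumes "0 \<le> b" "\<And>s. 0 \<le> v s" "0 < demand P v b n" "s \<in> {1..n}" "P s"
  shows "withdrawal P v b s = v s"
  using assms(3,4)
proof (induction n)
  case (Suc n)
  have nonneg: "0 \<le> demand P v b n" "0 \<le> v (Suc n)" using demand_bounds[OF assms(1,2)] assms(2) by auto
  show ?case
  proof (cases "s = Suc n")
    case True
    then show ?thesis using Suc.prems(1) assms(5) by (auto simp: withdrawal_def min_def split: if_splits)
  next
    case False
    then have "0 < demand P v b n"
      using Suc.prems(1) nonneg by (auto simp: min_def split: if_splits)
    then show ?thesis using Suc.IH Suc.prems(2) False by auto
  qed
qed simp

section \<open>Range estimates, learning rates and vault balances for a fixed arm sequence\<close>

context
  fixes l :: "nat \<Rightarrow> nat \<Rightarrow> real" and d :: "nat \<Rightarrow> nat" and A :: "nat \<Rightarrow> nat"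
begin

lemma finite_revealed: "finite {2 * l s (A s) |s. s \<in> {1..t} \<and> s + d s = t}"
  by (rule finite_surj[of "{1..t}" _ "\<lambda>s. 2 * l s (A s)"]) auto

lemma Lhat_le_Suc: "Lhat l d A t \<le> Lhat l d A (Suc t)"
  unfolding Lhat.simps using finite_revealed[of t] by (intro Max_ge) auto

lemma Lhat_mono: "s \<le> t \<Longrightarrow> Lhat l d A s \<le> Lhat l d A t"
  by (rule lift_Suc_mono_le[of "Lhat l d A"]) (use Lhat_le_Suc in auto)

lemma Lhat_ge_1: "1 \<le> Lhat l d A t"
  using Lhat_mono[of 0 t] by simp

text \<open>The feedback of \<open>s\<close> enters at the end of round \<open>s + d s\<close> and
  thus first affects the estimate of the following round.\<close>

lemma Lhat_ge_revealed:
  assumes "1 \<le> s" "s + d s < t"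
  shows "2 * l s (A s) \<le> Lhat l d A t"
proof -
  have "2 * l s (A s) \<le> Lhat l d A (Suc (s + d s))"
    unfolding Lhat.simps using finite_revealed[of "s + d s"] assms(1) by (intro Max_ge) auto
  also have "\<dots> \<le> Lhat l d A t" using assms(2) by (intro Lhat_mono) auto
  finally show ?thesis .
qed

lemma Lhat_le:
  assumes "1 \<le> B" "\<And>s. s \<in> {1..<t} \<Longrightarrow> 2 * l s (A s) \<le> B"
  shows "Lhat l d A t \<le> B"
  using assms(2)
proof (induction t)
  case (Suc t)
  then have "Lhat l d A t \<le> B" by simp
  then show ?case
    unfolding Lhat.simps using finite_revealed[of t] Suc.prems by (intro Max.boundedI) auto
qed (use assms(1) in simp)

lemma Missing_iff: "round_status l d A t s = Missing \<longleftrightarrow> t \<le> s + d s"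
  by (simp add: round_status_def)

lemma num_missing_eq: "num_missing l d A t = card {s \<in> {1..<t}. t \<le> s + d s}"
  by (simp add: num_missing_def Missing_iff)

text \<open>Double counting of pairs: round \<open>s\<close> is missing in at most the
  \<open>d s\<close> rounds that follow it.\<close>

lemma sum_num_missing_le: "(\<Sum>t=1..n. num_missing l d A t) \<le> total_delay d n"
proof -
  have "(\<Sum>t=1..n. num_missing l d A t) = (\<Sum>t=1..n. \<Sum>s=1..n. if s < t \<and> t \<le> s + d s then 1 else 0)"
    unfolding num_missing_eq
    by (intro sum.cong refl, subst sum.inter_filter[symmetric])
      (auto intro!: arg_cong[where f = card])
  also have "\<dots> = (\<Sum>s=1..n. \<Sum>t=1..n. if s < t \<and> t \<le> s + d s then 1 else 0)"
    by (rule sum.swap)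
  also have "\<dots> = (\<Sum>s=1..n. card {t \<in> {1..n}. s < t \<and> t \<le> s + d s})"
    by (intro sum.cong refl, subst sum.inter_filter[symmetric]) auto
  also have "\<dots> \<le> (\<Sum>s=1..n. d s)"
  proof (intro sum_mono)
    fix s
    have "card {t \<in> {1..n}. s < t \<and> t \<le> s + d s} \<le> card {s<..s + d s}"
      by (intro card_mono) auto
    then show "card {t \<in> {1..n}. s < t \<and> t \<le> s + d s} \<le> d s" by simp
  qed
  finally show ?thesis by (simp add: total_delay_def)
qed

lemma sum_num_missing_Suc_le: "(\<Sum>t=1..n. real (num_missing l d A t) + 1) \<le> real (total_delay d n + n)"
proof -
  have "(\<Sum>t=1..n. real (num_missing l d A t) + 1) = real (\<Sum>t=1..n. num_missing l d A t) + real n"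
    by (simp add: sum.distrib)
  then show ?thesis using sum_num_missing_le[of n] by linarith
qed

lemma total_delay_mono: "m \<le> n \<Longrightarrow> total_delay d m \<le> total_delay d n"
  unfolding total_delay_def by (intro sum_mono2) auto

lemma cumD_le: "cumD l d A t \<le> real (total_delay d t + t) * (Lhat l d A t)\<^sup>2"
proof -
  have "cumD l d A t \<le> (\<Sum>s=1..t. (real (num_missing l d A s) + 1) * (Lhat l d A t)\<^sup>2)"
    unfolding cumD_def using Lhat_mono Lhat_ge_1
    by (intro sum_mono mult_left_mono power_mono) (auto intro: order_trans[of 0 1])
  also have "\<dots> = (\<Sum>s=1..t. real (num_missing l d A s) + 1) * (Lhat l d A t)\<^sup>2"
    by (simp only: sum_distrib_right)
  finally show ?thesis using sum_num_missing_Suc_le[of t] by (meson mult_right_mono order_trans zero_le_power2)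
qed

lemma cumD_le':
  assumes "t \<le> n"
  shows "cumD l d A t \<le> real (total_delay d n + n) * (Lhat l d A t)\<^sup>2"
proof -
  have "real (total_delay d t + t) \<le> real (total_delay d n + n)"
    using total_delay_mono[OF assms] assms by linarith
  then show ?thesis using cumD_le[of t] by (meson mult_right_mono order_trans zero_le_power2)
qed

lemma cumD_nonneg: "0 \<le> cumD l d A t"
  unfolding cumD_def by (intro sum_nonneg) auto

lemma cumD_ge:
  assumes "1 \<le> t"
  shows "real (num_missing l d A t) + 1 \<le> cumD l d A t / (Lhat l d A t)\<^sup>2"
proof -
  have "(real (num_missing l d A t) + 1) * (Lhat l d A t)\<^sup>2 \<le> cumD l d A t"
    unfolding cumD_def using assms by (intro member_le_sum) auto
  then show ?thesis using Lhat_ge_1[of t] by (subst pos_le_divide_eq) (auto simp: zero_less_power2)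
qed

lemma sigma_pos: "0 < sigma l d A t"
proof -
  have "0 < ln (3 + cumD l d A t / (Lhat l d A t)\<^sup>2)" using cumD_nonneg[of t] by (intro ln_gt_zero) (simp add: add_pos_nonneg add.commute add_strict_increasing)
  then show ?thesis using cumD_nonneg[of t] by (auto simp: sigma_def intro!: mult_pos_pos divide_pos_pos)
qed

lemma inverse_sigma: "1 / sigma l d A t = (real (num_missing l d A t) + 1) * sqrt (ln (3 + cumD l d A t / (Lhat l d A t)\<^sup>2) / (3 + cumD l d A t))"
  by (simp add: sigma_def inverse_eq_divide)

text \<open>Separates a factor depending on the horizon and the range estimate from a decreasing
  function of the missing count. The last summand of \<open>cumD\<close> alone keeps the logarithm
  above \<open>ln (4 + num_missing)\<close>.\<close>

lemma sigma_le:
  assumes "1 \<le> t" "t \<le> n"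
  shows "sigma l d A t \<le> sqrt (3 + real (total_delay d n + n) * (Lhat l d A t)\<^sup>2) *
    (1 / ((real (num_missing l d A t) + 1) * sqrt (ln (4 + real (num_missing l d A t)))))"
proof -
  let ?m = "real (num_missing l d A t)"
  have le: "4 + ?m \<le> 3 + cumD l d A t / (Lhat l d A t)\<^sup>2" using cumD_ge[OF assms(1)] by simp
  have "sigma l d A t = sqrt (3 + cumD l d A t) * (1 / ((?m + 1) * sqrt (ln (3 + cumD l d A t / (Lhat l d A t)\<^sup>2))))"
    by (simp add: sigma_def real_sqrt_divide field_simps)
  also have "\<dots> \<le> sqrt (3 + real (total_delay d n + n) * (Lhat l d A t)\<^sup>2) * (1 / ((?m + 1) * sqrt (ln (4 + ?m))))"
  proof (rule mult_mono)
    show "1 / ((?m + 1) * sqrt (ln (3 + cumD l d A t / (Lhat l d A t)\<^sup>2))) \<le> 1 / ((?m + 1) * sqrt (ln (4 + ?m)))"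
      using le by (intro divide_left_mono mult_left_mono real_sqrt_le_mono mult_pos_pos) auto
  qed (use cumD_le'[OF assms(2)] cumD_nonneg[of t] le in auto)
  finally show ?thesis .
qed

lemma usable_iff: "usable l d A t s \<longleftrightarrow> s \<in> {1..<t} \<and> s + d s < t \<and> l s (A s) \<le> Lhat l d A s"
  by (auto simp: usable_def round_status_def)

lemma vault_nonneg: "0 \<le> vault l d A t s"
proof (induction t arbitrary: s)
  case (Suc t)
  then show ?case
    using withdrawal_bounds(2)[of "sigma l d A (Suc t)" "vault l d A t"] sigma_pos[of "Suc t"] by (auto simp: less_imp_le)
qed simp

lemma invest_Suc: "invest l d A (Suc t) = demand (usable l d A (Suc t)) (vault l d A t) (sigma l d A (Suc t)) t"
  by (simp add: invest_def)

lemma sigma2_Suc: "sigma2 l d A (Suc t) s = withdrawal (usable l d A (Suc t)) (vault l d A t) (sigma l d A (Suc t)) s"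
  by (simp add: sigma2_def)

lemma vault_Suc: "vault l d A (Suc t) s = (if s = Suc t then sigma l d A (Suc t) else vault l d A t s - sigma2 l d A (Suc t) s)"
  by (simp add: sigma2_Suc)

lemma sigma2_nonneg: "0 \<le> sigma2 l d A t s"
  unfolding sigma2_def using withdrawal_bounds(1)[of "sigma l d A t" "vault l d A (t - 1)"] sigma_pos[of t] vault_nonneg
  by (simp add: less_imp_le)

lemma invest_nonneg: "0 \<le> invest l d A t"
  unfolding invest_def using demand_bounds(1)[of "sigma l d A t" "vault l d A (t - 1)"] sigma_pos[of t] vault_nonneg
  by (simp add: less_imp_le)

lemma sum_sigma2: "(\<Sum>s=1..t. sigma2 l d A (Suc t) s) = sigma l d A (Suc t) - invest l d A (Suc t)"
  unfolding sigma2_Suc invest_Suc by (rule sum_withdrawal)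

text \<open>Conservation: a round takes \<open>sigma - invest\<close> from the old accounts and
  deposits \<open>sigma\<close>, so the total balance grows by exactly the investment.\<close>

lemma sum_invest_eq_vault: "(\<Sum>s=1..t. invest l d A s) = (\<Sum>s=1..t. vault l d A t s)"
proof (induction t)
  case (Suc t)
  have "(\<Sum>s=1..t. vault l d A (Suc t) s) = (\<Sum>s=1..t. vault l d A t s - sigma2 l d A (Suc t) s)"
    unfolding vault_Suc by (intro sum.cong) auto
  also have "\<dots> = (\<Sum>s=1..t. vault l d A t s) - (sigma l d A (Suc t) - invest l d A (Suc t))"
    by (simp only: sum_subtractf sum_sigma2)
  moreover have "vault l d A (Suc t) (Suc t) = sigma l d A (Suc t)" by simp
  ultimately show ?case using Suc.IH by simp
qed simp

lemma vault_le_sigma: "1 \<le> s \<Longrightarrow> s \<le> t \<Longrightarrow> vault l d A t s \<le> sigma l d A s"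
proof (induction t)
  case (Suc t)
  then show ?case using sigma2_nonneg[of "Suc t" s] by (cases "s = Suc t") (auto simp: vault_Suc simp del: vault.simps)
qed simp

lemma vault_usable_eq_0:
  assumes "0 < invest l d A (Suc t)" "usable l d A (Suc t) s"
  shows "vault l d A (Suc t) s = 0"
proof -
  have s: "s \<in> {1..t}" "s \<noteq> Suc t" using assms(2) by (auto simp: usable_iff)
  have "sigma2 l d A (Suc t) s = vault l d A t s"
    unfolding sigma2_Suc
    by (rule demand_positive_imp_emptied[where n = t])
      (use s assms vault_nonneg sigma_pos[of "Suc t"] in \<open>auto simp: invest_Suc\<close>)
  then show ?thesis using s by (simp add: vault_Suc del: vault.simps)
qed

text \<open>A demand is left over only if all accounts that could pay are empty, so at such a time the
  total investment rests with rounds that are still missing or were skipped.\<close>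

lemma sum_invest_le:
  assumes "\<And>t. t \<in> {1..n} \<Longrightarrow> (\<Sum>s \<in> {s \<in> {1..t}. t \<le> s + d s}. sigma l d A s) \<le> B"
  assumes "t \<le> n" "0 \<le> B"
  shows "(\<Sum>s=1..t. invest l d A s) \<le> B + (\<Sum>s \<in> {s \<in> {1..n}. Lhat l d A s < l s (A s)}. sigma l d A s)"
  using assms(2)
proof (induction t)
  case 0
  then show ?case using assms(3) by (auto intro!: add_nonneg_nonneg sum_nonneg less_imp_le[OF sigma_pos])
next
  case (Suc t)
  show ?case
  \<comment> \<open>The total changes only in rounds with leftover demand, so the bound has to be
    checked only there.\<close>
  proof (cases "invest l d A (Suc t) = 0")
    case False
    then have pos: "0 < invest l d A (Suc t)" using invest_nonneg[of "Suc t"] by linarith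
    \<comment> \<open>The pending set contains round \<open>Suc t\<close> itself, whose fresh
      deposit is still untouched.\<close>
    let ?M = "{s \<in> {1..Suc t}. Suc t \<le> s + d s}" and ?S = "{s \<in> {1..n}. Lhat l d A s < l s (A s)}"
    have "(\<Sum>s=1..Suc t. invest l d A s) = (\<Sum>s=1..Suc t. vault l d A (Suc t) s)" by (rule sum_invest_eq_vault)
    also have "\<dots> = (\<Sum>s\<in>?M \<union> (?S \<inter> {1..Suc t}). vault l d A (Suc t) s)"
    proof (rule sum.mono_neutral_right)
      show "\<forall>s\<in>{1..Suc t} - (?M \<union> (?S \<inter> {1..Suc t})). vault l d A (Suc t) s = 0"
      proof
        fix s assume "s \<in> {1..Suc t} - (?M \<union> (?S \<inter> {1..Suc t}))"
        then have "usable l d A (Suc t) s" using Suc.prems by (auto simp: usable_iff)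
        then show "vault l d A (Suc t) s = 0" using vault_usable_eq_0 pos by blast
      qed
    qed auto
    also have "\<dots> \<le> (\<Sum>s\<in>?M \<union> (?S \<inter> {1..Suc t}). sigma l d A s)"
      by (intro sum_mono vault_le_sigma) auto
    also have "\<dots> \<le> (\<Sum>s\<in>?M. sigma l d A s) + (\<Sum>s\<in>?S \<inter> {1..Suc t}. sigma l d A s)"
      by (subst sum_Un) (auto intro!: sum_nonneg less_imp_le[OF sigma_pos])
    also have "(\<Sum>s\<in>?S \<inter> {1..Suc t}. sigma l d A s) \<le> (\<Sum>s\<in>?S. sigma l d A s)"
      by (intro sum_mono2) (auto intro!: less_imp_le[OF sigma_pos])
    also have "(\<Sum>s\<in>?M. sigma l d A s) \<le> B" using assms(1)[of "Suc t"] Suc.prems by simp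
    finally show ?thesis by simp
  qed (use Suc in simp)
qed

end

section \<open>Concurrent rounds\<close>

text \<open>Dyadic peeling: remove the elements whose \<open>f\<close> exceeds half of the maximum,
  pay \<open>c\<close> times the maximum for them, and recurse on a rest with half the maximum. The
  geometric series costs the factor 2.\<close>

lemma halving_sum_le:
  fixes f g :: "'a \<Rightarrow> real"
  assumes "finite S" "\<And>s. s \<in> S \<Longrightarrow> 0 < f s" "\<And>s. s \<in> S \<Longrightarrow> f s \<le> M" "0 \<le> M" "0 \<le> c"
    and level: "\<And>U M. U \<subseteq> S \<Longrightarrow> 0 \<le> M \<Longrightarrow> (\<And>s. s \<in> U \<Longrightarrow> M / 2 < f s \<and> f s \<le> M) \<Longrightarrow> sum g U \<le> c * M"
  shows "sum g S \<le> 2 * c * M"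
  using assms(1-4) level
proof (induction S arbitrary: M rule: finite_psubset_induct)
  case (psubset S)
  show ?case
  proof (cases "S = {}")
    case False
    define m where "m = Max (f ` S)"
    have "m \<in> f ` S" unfolding m_def using psubset.hyps False by (intro Max_in) auto
    then obtain k where k: "k \<in> S" "f k = m" by auto
    have mpos: "0 < m" using psubset.prems(1)[of k] k by simp
    have fm: "f s \<le> m" if "s \<in> S" for s using psubset.hyps that by (simp add: m_def)
    let ?U = "{s \<in> S. m / 2 < f s}"
    have "sum g (S - ?U) \<le> 2 * c * (m / 2)"
    proof (rule psubset.IH)
      have "k \<in> ?U" using k mpos by simp
      then show "S - ?U \<subset> S" using k(1) by blast
      show "sum g U \<le> c * M"
        if "U \<subseteq> S - ?U" "0 \<le> M" "\<And>s. s \<in> U \<Longrightarrow> M / 2 < f s \<and> f s \<le> M" for U M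
        by (rule psubset.prems(4)) (use that in auto)
    qed (use psubset.prems(1) mpos in auto)
    moreover have "sum g ?U \<le> c * m"
      by (rule psubset.prems(4)) (use fm mpos in auto)
    moreover have "sum g S = sum g (S - ?U) + sum g ?U"
      by (rule sum.subset_diff) (use psubset.hyps in auto)
    ultimately have "sum g S \<le> 2 * (c * m)" by simp
    also have "c * m \<le> c * M"
      using psubset.prems(2)[OF k(1)] k assms(5) by (intro mult_left_mono) auto
    finally show ?thesis by simp
  qed (use psubset.prems(3) assms(5) in simp)
qed

text \<open>A discrete derivative of \<open>sqrt (ln x)\<close>, prepared for telescoping. The
  factor 8 collects 2 from \<open>a + b \<le> 2 * a\<close> and 4 from
  \<open>1 / (j + 1) \<le> 4 / (4 + j)\<close>.\<close>

lemma sqrt_ln_increment: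
  "1 / ((real j + 1) * sqrt (ln (4 + real j))) \<le> 8 * (sqrt (ln (4 + real j)) - sqrt (ln (3 + real j)))"
proof -
  define a b where "a = sqrt (ln (4 + real j))" and "b = sqrt (ln (3 + real j))"
  have ab: "0 < a" "b \<le> a" by (auto simp: a_def b_def)
  have "ln ((3 + real j) / (4 + real j)) \<le> (3 + real j) / (4 + real j) - 1"
    by (rule ln_le_minus_one) auto
  also have "\<dots> = - 1 / (4 + real j)" by (simp add: field_simps)
  finally have "1 / (4 + real j) \<le> ln (4 + real j) - ln (3 + real j)"
    by (simp add: ln_div)
  also have "\<dots> = (a - b) * (a + b)"
    by (simp add: a_def b_def algebra_simps)
  also have "\<dots> \<le> (a - b) * (2 * a)" using ab by (intro mult_left_mono) auto
  finally have *: "1 / (4 + real j) \<le> (a - b) * (2 * a)" .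
  have "1 / (real j + 1) \<le> 4 * (1 / (4 + real j))" by (simp add: field_simps)
  with * have "1 / (real j + 1) \<le> 8 * (a - b) * a" by linarith
  then have "1 / (real j + 1) / a \<le> 8 * (a - b)"
    using ab(1) by (subst pos_divide_le_eq)
  then show ?thesis unfolding a_def[symmetric] b_def[symmetric] by simp
qed

lemma sum_inverse_sqrt_ln_le:
  "(\<Sum>j<m. 1 / ((real j + 1) * sqrt (ln (4 + real j)))) \<le> 8 * sqrt (ln (3 + real m))"
proof (induction m)
  case (Suc m)
  have "(\<Sum>j<Suc m. 1 / ((real j + 1) * sqrt (ln (4 + real j))))
    \<le> 8 * sqrt (ln (3 + real m)) + 8 * (sqrt (ln (4 + real m)) - sqrt (ln (3 + real m)))"
    using Suc.IH sqrt_ln_increment[of m] by (simp only: sum.lessThan_Suc)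
  then show ?case by (simp add: add.commute)
qed simp

section \<open>Learning rates and losses of simultaneously pending or skipped rounds\<close>

context
  fixes l :: "nat \<Rightarrow> nat \<Rightarrow> real" and d :: "nat \<Rightarrow> nat" and A :: "nat \<Rightarrow> nat"
begin

text \<open>Each earlier member of \<open>U\<close> is still missing at the start of each later
  one.\<close>

definition concurrent :: "nat set \<Rightarrow> bool" where
  "concurrent U \<longleftrightarrow> (\<forall>s\<in>U. \<forall>s'\<in>U. s < s' \<longrightarrow> s' \<le> s + d s)"

text \<open>Induction on the largest round: it sees all other members of \<open>U\<close> as
  missing, so its count is at least their number, and \<open>h\<close> is decreasing.\<close>

lemma concurrent_sum_le:
  assumes "finite U" "U \<subseteq> {1..}" "concurrent U"
    and h: "\<And>i j. i \<le> j \<Longrightarrow> h j \<le> (h i :: real)"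
  shows "(\<Sum>s\<in>U. h (num_missing l d A s)) \<le> (\<Sum>j<card U. h j)"
  using assms(1-3)
proof (induction U rule: finite_linorder_max_induct)
  case (insert m U)
  have m: "m \<notin> U" using insert.hyps by auto
  have "card U \<le> num_missing l d A m"
    unfolding num_missing_eq
    using insert.hyps insert.prems by (intro card_mono) (auto simp: concurrent_def)
  then have "h (num_missing l d A m) \<le> h (card U)" by (rule h)
  moreover have "(\<Sum>s\<in>U. h (num_missing l d A s)) \<le> (\<Sum>j<card U. h j)"
    using insert.prems by (intro insert.IH) (auto simp: concurrent_def)
  ultimately show ?case using insert.hyps(1) m by simp
qed simp

text \<open>The values \<open>num_missing + 1\<close> over \<open>k\<close> concurrent rounds sum to
  at least \<open>1 + ... + k\<close>, while their total over all rounds is at most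
  \<open>total_delay d n + n\<close>. The signs are flipped because \<open>concurrent_sum_le\<close>
  takes a decreasing function.\<close>

lemma concurrent_card_le:
  assumes "U \<subseteq> {1..n}" "concurrent U"
  shows "real (card U) \<le> sqrt (2 * real (total_delay d n + n))"
proof (rule real_le_rsqrt)
  have fin: "finite U" using assms(1) finite_subset by blast
  have "(\<Sum>s\<in>U. - (real (num_missing l d A s) + 1)) \<le> (\<Sum>j<card U. - (real j + 1))"
    by (rule concurrent_sum_le[of U "\<lambda>j. - (real j + 1)"]) (use fin assms in auto)
  then have "(\<Sum>j<card U. real j + 1) \<le> (\<Sum>s\<in>U. real (num_missing l d A s) + 1)"
    unfolding sum_negf by linarith
  also have "\<dots> \<le> (\<Sum>s=1..n. real (num_missing l d A s) + 1)"
    using assms(1) by (intro sum_mono2) auto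
  also have "\<dots> \<le> real (total_delay d n + n)" by (rule sum_num_missing_Suc_le)
  also have "(\<Sum>j<m. real j + 1) = (real m)\<^sup>2 / 2 + real m / 2" for m
    by (induction m) (auto simp: power2_eq_square field_simps)
  finally have "(real (card U))\<^sup>2 / 2 + real (card U) / 2 \<le> real (total_delay d n + n)" .
  moreover have "0 \<le> real (card U)" by simp
  ultimately show "(real (card U))\<^sup>2 \<le> 2 * real (total_delay d n + n)" by argo
qed

lemma concurrent_sum_sigma_le:
  assumes "U \<subseteq> {1..n}" "concurrent U" "\<And>s. s \<in> U \<Longrightarrow> Lhat l d A s \<le> M" "1 \<le> M"
  defines "N \<equiv> real (total_delay d n + n)"
  shows "(\<Sum>s\<in>U. sigma l d A s) \<le> 8 * (sqrt (3 + N) * sqrt (ln (3 + N))) * M"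
proof -
  have fin: "finite U" using assms(1) finite_subset by blast
  have N0: "0 \<le> N" by (simp add: N_def)
  have "(\<Sum>s\<in>U. sigma l d A s) \<le> (\<Sum>s\<in>U. sqrt (3 + N) * M *
      (1 / ((real (num_missing l d A s) + 1) * sqrt (ln (4 + real (num_missing l d A s))))))"
  proof (intro sum_mono)
    fix s assume s: "s \<in> U"
    have L1: "1 \<le> Lhat l d A s" by (rule Lhat_ge_1)
    \<comment> \<open>Since \<open>M\<close> is at least 1, the additive 3 can be scaled by
      \<open>M^2\<close> as well.\<close>
    have "3 + N * (Lhat l d A s)\<^sup>2 \<le> (3 + N) * M\<^sup>2"
    proof -
      have "(Lhat l d A s)\<^sup>2 \<le> M\<^sup>2" using assms(3)[OF s] L1 by (intro power_mono) auto
      then have "N * (Lhat l d A s)\<^sup>2 \<le> N * M\<^sup>2" using N0 by (rule mult_left_mono)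
      moreover have "1 \<le> M\<^sup>2" using assms(4) by simp
      ultimately show ?thesis by (simp add: algebra_simps)
    qed
    then have "sqrt (3 + N * (Lhat l d A s)\<^sup>2) \<le> sqrt ((3 + N) * M\<^sup>2)" by (rule real_sqrt_le_mono)
    also have "\<dots> = sqrt (3 + N) * M" using assms(4) by (simp add: real_sqrt_mult)
    finally have "sqrt (3 + N * (Lhat l d A s)\<^sup>2) \<le> sqrt (3 + N) * M" .
    moreover have "s \<in> {1..n}" using assms(1) s by auto
    ultimately show "sigma l d A s \<le> sqrt (3 + N) * M *
        (1 / ((real (num_missing l d A s) + 1) * sqrt (ln (4 + real (num_missing l d A s)))))"
      unfolding N_def by (intro order_trans[OF sigma_le[of s n] mult_right_mono]) auto
  qed
  also have "\<dots> = sqrt (3 + N) * M * (\<Sum>s\<in>U. 1 / ((real (num_missing l d A s) + 1) * sqrt (ln (4 + real (num_missing l d A s)))))"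
    by (rule sum_distrib_left[symmetric])
  also have "\<dots> \<le> sqrt (3 + N) * M * (8 * sqrt (ln (3 + N)))"
  proof (intro mult_left_mono)
    have "(\<Sum>s\<in>U. 1 / ((real (num_missing l d A s) + 1) * sqrt (ln (4 + real (num_missing l d A s)))))
        \<le> (\<Sum>j<card U. 1 / ((real j + 1) * sqrt (ln (4 + real j))))"
      by (rule concurrent_sum_le[of U "\<lambda>j. 1 / ((real j + 1) * sqrt (ln (4 + real j)))"])
        (use fin assms in \<open>auto intro!: divide_left_mono mult_mono mult_pos_pos\<close>)
    also have "\<dots> \<le> 8 * sqrt (ln (3 + real (card U)))" by (rule sum_inverse_sqrt_ln_le)
    also have "\<dots> \<le> 8 * sqrt (ln (3 + N))"
    proof -
      have "card U \<le> n" using card_mono[OF _ assms(1)] by simp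
      then show ?thesis by (simp add: N_def)
    qed
    finally show "(\<Sum>s\<in>U. 1 / ((real (num_missing l d A s) + 1) * sqrt (ln (4 + real (num_missing l d A s))))) \<le> 8 * sqrt (ln (3 + N))" .
  qed (use N0 assms(4) in auto)
  finally show ?thesis by (simp add: mult_ac)
qed

abbreviation "skipped n \<equiv> {s \<in> {1..n}. Lhat l d A s < l s (A s)}"

text \<open>Once the feedback of a skipped round arrives, the doubled estimate exceeds every loss of the
  same dyadic level, so the skipped rounds of one level are all pending at the same time.\<close>

lemma concurrent_skipped_level:
  assumes "U \<subseteq> skipped n" "\<And>s. s \<in> U \<Longrightarrow> M / 2 < l s (A s) \<and> l s (A s) \<le> M"
  shows "concurrent U"
  unfolding concurrent_def
proof (intro ballI impI, rule ccontr)
  fix s s' assume *: "s \<in> U" "s' \<in> U" "s < s'" "\<not> s' \<le> s + d s"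
  then have "2 * l s (A s) \<le> Lhat l d A s'" using assms(1) by (intro Lhat_ge_revealed) auto
  moreover have "Lhat l d A s' < l s' (A s')" using assms(1) *(2) by auto
  ultimately show False using assms(2)[OF *(1)] assms(2)[OF *(2)] by linarith
qed

lemma skipped_loss_gt_1: "s \<in> skipped n \<Longrightarrow> 1 < l s (A s)"
  using Lhat_ge_1[of l d A s] by auto

text \<open>Peeling by loss size. On a level with losses in \<open>(M / 2, M]\<close> the range
  estimate lies below the skipped loss, hence below \<open>M\<close>, so the bound for concurrent
  rounds scales with the level.\<close>

lemma sum_sigma_skipped_le:
  assumes "\<And>s. s \<in> {1..n} \<Longrightarrow> l s (A s) \<le> M" "0 \<le> M"
  defines "N \<equiv> real (total_delay d n + n)"
  shows "(\<Sum>s\<in>skipped n. sigma l d A s) \<le> 2 * (8 * (sqrt (3 + N) * sqrt (ln (3 + N)))) * M"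
proof (rule halving_sum_le)
  fix U M assume U: "U \<subseteq> skipped n" "0 \<le> M" "\<And>s. s \<in> U \<Longrightarrow> M / 2 < l s (A s) \<and> l s (A s) \<le> M"
  show "(\<Sum>s\<in>U. sigma l d A s) \<le> 8 * (sqrt (3 + N) * sqrt (ln (3 + N))) * M"
  proof (cases "U = {}")
    case False
    then obtain u where "u \<in> U" by auto
    then have "1 \<le> M" using skipped_loss_gt_1[of u n] U by fastforce
    moreover have "Lhat l d A s \<le> M" if "s \<in> U" for s using U(1) U(3)[OF that] that by fastforce
    ultimately show ?thesis
      unfolding N_def using U(1) by (intro concurrent_sum_sigma_le concurrent_skipped_level[OF U(1,3)]) auto
  qed (use U(2) in \<open>auto simp: N_def\<close>)
next
  show "0 \<le> 8 * (sqrt (3 + N) * sqrt (ln (3 + N)))" by (auto simp: N_def)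
qed (use assms skipped_loss_gt_1 in force)+

text \<open>The same peeling, now paying the full loss: one level is concurrent and so contains at
  most \<open>sqrt (2 * (D + n))\<close> rounds.\<close>

lemma sum_loss_skipped_le:
  assumes "\<And>s. s \<in> {1..n} \<Longrightarrow> l s (A s) \<le> M" "0 \<le> M"
  shows "(\<Sum>s\<in>skipped n. l s (A s)) \<le> 2 * sqrt (2 * real (total_delay d n + n)) * M"
proof (rule halving_sum_le)
  fix U M assume U: "U \<subseteq> skipped n" "0 \<le> M" "\<And>s. s \<in> U \<Longrightarrow> M / 2 < l s (A s) \<and> l s (A s) \<le> M"
  have "(\<Sum>s\<in>U. l s (A s)) \<le> real (card U) * M" using U(3) by (intro sum_bounded_above) auto
  also have "\<dots> \<le> sqrt (2 * real (total_delay d n + n)) * M"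
    using U(1,2) by (intro mult_right_mono concurrent_card_le concurrent_skipped_level[OF U(1,3)]) auto
  finally show "(\<Sum>s\<in>U. l s (A s)) \<le> sqrt (2 * real (total_delay d n + n)) * M" .
qed (use assms skipped_loss_gt_1 in force)+

text \<open>\<open>R\<close> bounds both the initial guess 1 and all doubled losses, hence every
  range estimate. Rounds pending at one time \<open>t\<close> are concurrent and contribute
  \<open>8 * R\<close>; skipped rounds contribute \<open>2 * 8 * M\<close>, which is again at most
  \<open>8 * R\<close>, up to the common square roots.\<close>

lemma sum_invest_bound:
  assumes "\<And>s. s \<in> {1..n} \<Longrightarrow> l s (A s) \<le> M" "0 \<le> M" "1 \<le> R" "2 * M \<le> R"
  defines "N \<equiv> real (total_delay d n + n)"
  shows "(\<Sum>t=1..n. invest l d A t) \<le> 16 * (sqrt (3 + N) * sqrt (ln (3 + N))) * R"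
proof -
  let ?c = "8 * (sqrt (3 + N) * sqrt (ln (3 + N)))"
  have c: "0 \<le> ?c" by (auto simp: N_def)
  have "(\<Sum>t=1..n. invest l d A t) \<le> ?c * R + (\<Sum>s\<in>skipped n. sigma l d A s)"
  proof (rule sum_invest_le)
    fix t assume t: "t \<in> {1..n}"
    have "Lhat l d A s \<le> R" if "s \<in> {1..n}" for s
      by (rule Lhat_le) (use assms(1,3,4) that in force)+
    then show "(\<Sum>s\<in>{s \<in> {1..t}. t \<le> s + d s}. sigma l d A s) \<le> ?c * R"
      unfolding N_def using t assms(3)
      by (intro concurrent_sum_sigma_le) (auto simp: concurrent_def)
  qed (use c assms(3) in auto)
  also have "(\<Sum>s\<in>skipped n. sigma l d A s) \<le> 2 * ?c * M"
    unfolding N_def by (rule sum_sigma_skipped_le[OF assms(1,2)])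
  also have "2 * ?c * M = ?c * (2 * M)" by simp
  also have "\<dots> \<le> ?c * R" using assms(4) c by (rule mult_left_mono)
  finally show ?thesis by (simp add: mult_ac)
qed

text \<open>Up to its logarithm, each term is the increment of \<open>cumD\<close> divided by
  \<open>sqrt (3 + cumD)\<close>, hence at most twice the increment of that square root. The
  logarithm is replaced by its final bound and the rest telescopes.\<close>

lemma sum_Lhat_div_sigma_le:
  assumes "\<And>t. t \<in> {1..n} \<Longrightarrow> Lhat l d A t \<le> R"
  defines "N \<equiv> real (total_delay d n + n)"
  assumes "1 \<le> R"
  shows "(\<Sum>t=1..n. (Lhat l d A t)\<^sup>2 / sigma l d A t) \<le> 2 * (sqrt (3 + N) * sqrt (ln (3 + N))) * R"
proof -
  have step: "(Lhat l d A t)\<^sup>2 / sigma l d A t \<le> sqrt (ln (3 + N)) * (2 * (sqrt (3 + cumD l d A t) - sqrt (3 + cumD l d A (t - 1))))"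
    if t: "t \<in> {1..n}" for t
  proof -
    define p q where "p = sqrt (3 + cumD l d A t)" and "q = sqrt (3 + cumD l d A (t - 1))"
    have inc: "cumD l d A t = cumD l d A (t - 1) + (real (num_missing l d A t) + 1) * (Lhat l d A t)\<^sup>2"
      using t by (cases t) (auto simp: cumD_def)
    have q: "0 < q" "q \<le> p" using cumD_nonneg[of l d A "t - 1"] inc by (auto simp: p_def q_def)
    have "(real (num_missing l d A t) + 1) * (Lhat l d A t)\<^sup>2 = (3 + cumD l d A t) - (3 + cumD l d A (t - 1))" using inc by simp
    also have "\<dots> = (p - q) * (p + q)"
      using cumD_nonneg[of l d A "t - 1"] cumD_nonneg[of l d A t] by (simp add: p_def q_def algebra_simps)
    also have "\<dots> \<le> (p - q) * (2 * p)" using q by (intro mult_left_mono) auto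
    finally have *: "(real (num_missing l d A t) + 1) * (Lhat l d A t)\<^sup>2 / p \<le> 2 * (p - q)"
      using q by (simp add: pos_divide_le_eq mult_ac)
    have "cumD l d A t / (Lhat l d A t)\<^sup>2 \<le> N"
      using cumD_le'[of t n l d A] t Lhat_ge_1[of l d A t]
      by (subst pos_divide_le_eq) (auto simp: N_def zero_less_power2)
    then have ln: "sqrt (ln (3 + cumD l d A t / (Lhat l d A t)\<^sup>2)) \<le> sqrt (ln (3 + N))"
    proof -
      have "0 \<le> cumD l d A t / (Lhat l d A t)\<^sup>2" using cumD_nonneg[of l d A t] by simp
      moreover from \<open>cumD l d A t / (Lhat l d A t)\<^sup>2 \<le> N\<close>
      have "3 + cumD l d A t / (Lhat l d A t)\<^sup>2 \<le> 3 + N" by simp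
      ultimately show ?thesis by (intro real_sqrt_le_mono) (subst ln_le_cancel_iff, linarith+)
    qed
    have "(Lhat l d A t)\<^sup>2 / sigma l d A t = (Lhat l d A t)\<^sup>2 * (1 / sigma l d A t)" by simp
    also have "\<dots> = sqrt (ln (3 + cumD l d A t / (Lhat l d A t)\<^sup>2)) * ((real (num_missing l d A t) + 1) * (Lhat l d A t)\<^sup>2 / p)"
      unfolding inverse_sigma p_def by (simp add: real_sqrt_divide)
    also have "\<dots> \<le> sqrt (ln (3 + N)) * (2 * (p - q))"
      using * ln q by (intro mult_mono) (auto simp: N_def)
    finally show ?thesis by (simp add: p_def q_def)
  qed
  have "(\<Sum>t=1..n. (Lhat l d A t)\<^sup>2 / sigma l d A t)
      \<le> (\<Sum>t=1..n. sqrt (ln (3 + N)) * (2 * (sqrt (3 + cumD l d A t) - sqrt (3 + cumD l d A (t - 1)))))"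
    by (intro sum_mono step)
  also have "\<dots> = sqrt (ln (3 + N)) * (2 * (sqrt (3 + cumD l d A n) - sqrt (3 + cumD l d A 0)))"
  proof -
    have "(\<Sum>t=1..n. sqrt (3 + cumD l d A t) - sqrt (3 + cumD l d A (t - 1))) = sqrt (3 + cumD l d A n) - sqrt (3 + cumD l d A 0)"
      by (induction n) auto
    then show ?thesis by (simp only: sum_distrib_left[symmetric])
  qed
  also have "\<dots> \<le> sqrt (ln (3 + N)) * (2 * (sqrt (3 + N) * R))"
  proof (intro mult_left_mono)
    have "cumD l d A n \<le> N * R\<^sup>2"
    proof -
      have "Lhat l d A n \<le> R" using assms(1)[of n] assms(3) by (cases n) auto
      then have "N * (Lhat l d A n)\<^sup>2 \<le> N * R\<^sup>2"
        using Lhat_ge_1[of l d A n] by (intro mult_left_mono power_mono) (auto simp: N_def)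
      then show ?thesis using cumD_le[of l d A n] by (simp add: N_def)
    qed
    moreover have "1 \<le> R\<^sup>2" using assms(3) by simp
    ultimately have "3 + cumD l d A n \<le> (3 + N) * R\<^sup>2" by (simp add: algebra_simps)
    then have "sqrt (3 + cumD l d A n) \<le> sqrt ((3 + N) * R\<^sup>2)" by (rule real_sqrt_le_mono)
    also have "\<dots> = sqrt (3 + N) * R" using assms(3) by (simp add: real_sqrt_mult)
    finally have "sqrt (3 + cumD l d A n) \<le> sqrt (3 + N) * R" .
    moreover have "0 \<le> sqrt (3 + cumD l d A 0)" by (simp add: cumD_def)
    ultimately show "sqrt (3 + cumD l d A n) - sqrt (3 + cumD l d A 0) \<le> sqrt (3 + N) * R" by linarith
  qed (auto simp: N_def)
  finally show ?thesis by (simp add: mult_ac)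
qed

end

section \<open>Pathwise regret of the linearized losses\<close>

text \<open>Three-point identity: the terms that depend on \<open>z\<close> alone cancel, and what
  remains is affine in the dual coordinates \<open>1 / sqrt (z i)\<close>.\<close>

lemma breg_diff:
  assumes "z \<in> pos_simplex K" "x \<in> prob_simplex K" "y \<in> prob_simplex K"
  shows "breg K y z - breg K x z = Psi K y - Psi K x + (\<Sum>i=1..K. (y i - x i) * (1 / sqrt (z i)))"
  unfolding breg_alt[OF assms(1,2)] breg_alt[OF assms(1,3)]
  by (simp add: sum_subtractf diff_divide_distrib)

lemma pos_simplex_imp_prob_simplex: "x \<in> pos_simplex K \<Longrightarrow> x \<in> prob_simplex K"
  by (simp add: pos_simplex_def)

lemma breg_self: "breg K x x = 0"
  by (simp add: breg_def)

lemma breg_eq: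
  assumes "x \<in> pos_simplex K" "y \<in> prob_simplex K"
  shows "breg K y x = Psi K y - Psi K x + (\<Sum>i=1..K. (y i - x i) * (1 / sqrt (x i)))"
  using breg_diff[OF assms(1) pos_simplex_imp_prob_simplex[OF assms(1)] assms(2)]
  by (simp add: breg_self)

text \<open>Eliminates the Lagrange multipliers, which are constant over the arms.\<close>

lemma sum_simplex_diff_const:
  assumes "x \<in> prob_simplex K" "y \<in> prob_simplex K"
  shows "(\<Sum>i=1..K. (y i - x i) * c) = 0"
  using assms by (simp add: sum_distrib_right[symmetric] sum_subtractf prob_simplex_def)

text \<open>Averaging dual coordinates averages the differences in \<open>breg_diff\<close> exactly;
  the inequality comes only from dropping the nonnegative divergences from \<open>x\<close> to the
  averaged points.\<close>

lemma breg_barycenter_le: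
  assumes x: "x \<in> pos_simplex K" and y: "y \<in> prob_simplex K" and u: "u \<in> pos_simplex K"
    and z: "\<And>s. s \<in> S \<Longrightarrow> z s \<in> pos_simplex K"
    and w: "\<And>s. s \<in> S \<Longrightarrow> 0 \<le> w s" "0 \<le> b" "W = (\<Sum>s\<in>S. w s) + b"
    and stationary: "\<And>i. i \<in> {1..K} \<Longrightarrow>
      W * (1 / sqrt (x i)) = c + (\<Sum>s\<in>S. w s * (1 / sqrt (z s i))) + b * (1 / sqrt (u i))"
  shows "W * breg K y x \<le> (\<Sum>s\<in>S. w s * breg K y (z s)) + b * breg K y u"
proof -
  have x': "x \<in> prob_simplex K" using x by (rule pos_simplex_imp_prob_simplex)
  let ?lin = "\<lambda>v. \<Sum>i=1..K. (y i - x i) * (1 / sqrt (v i))"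
  have "W * ?lin x = (\<Sum>i=1..K. (y i - x i) * (W * (1 / sqrt (x i))))"
    by (simp add: sum_distrib_left mult_ac)
  also have "\<dots> = (\<Sum>i=1..K. (y i - x i) * (c + (\<Sum>s\<in>S. w s * (1 / sqrt (z s i))) + b * (1 / sqrt (u i))))"
    by (intro sum.cong refl) (simp only: stationary)
  also have "\<dots> = (\<Sum>i=1..K. (y i - x i) * c)
      + (\<Sum>i=1..K. \<Sum>s\<in>S. w s * ((y i - x i) * (1 / sqrt (z s i)))) + b * ?lin u"
    by (simp add: sum.distrib distrib_left sum_distrib_left mult_ac)
  also have "(\<Sum>i=1..K. (y i - x i) * c) = 0" by (rule sum_simplex_diff_const[OF x' y])
  also have "(\<Sum>i=1..K. \<Sum>s\<in>S. w s * ((y i - x i) * (1 / sqrt (z s i)))) = (\<Sum>s\<in>S. w s * ?lin (z s))"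
    by (subst sum.swap) (simp add: sum_distrib_left)
  finally have lin: "W * ?lin x = (\<Sum>s\<in>S. w s * ?lin (z s)) + b * ?lin u" by simp
  have "W * breg K y x = W * (Psi K y - Psi K x) + W * ?lin x"
    unfolding breg_eq[OF x y] by (simp add: distrib_left)
  also have "\<dots> = (\<Sum>s\<in>S. w s * (Psi K y - Psi K x + ?lin (z s))) + b * (Psi K y - Psi K x + ?lin u)"
    unfolding lin unfolding w(3) by (simp add: distrib_left distrib_right sum.distrib sum_distrib_right)
  also have "\<dots> = (\<Sum>s\<in>S. w s * (breg K y (z s) - breg K x (z s))) + b * (breg K y u - breg K x u)"
    using breg_diff[OF z x' y] breg_diff[OF u x' y] by simp
  also have "\<dots> \<le> (\<Sum>s\<in>S. w s * breg K y (z s)) + b * breg K y u"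
    using breg_nonneg[OF pos_simplex_imp_prob_simplex[OF z]] breg_nonneg[OF pos_simplex_imp_prob_simplex[OF u]] w
    by (intro add_mono sum_mono mult_left_mono) auto
  finally show ?thesis .
qed

text \<open>Up to the constant \<open>c\<close>, \<open>g\<close> is \<open>\<sigma>\<close> times
  the displacement of the dual coordinates, so pairing it with \<open>x - y\<close> yields a
  three-point identity.\<close>

lemma mirror_step_eq:
  assumes x: "x \<in> pos_simplex K" and z: "z \<in> pos_simplex K" and y: "y \<in> prob_simplex K"
    and stationary: "\<And>i. i \<in> {1..K} \<Longrightarrow> \<sigma> * (1 / sqrt (z i)) = c + \<sigma> * (1 / sqrt (x i)) + g i"
  shows "(\<Sum>i=1..K. g i * (x i - y i)) = \<sigma> * (breg K y x - breg K y z + breg K x z)"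
proof -
  have x': "x \<in> prob_simplex K" using x by (rule pos_simplex_imp_prob_simplex)
  have "breg K y x - breg K y z + breg K x z
      = (\<Sum>i=1..K. (y i - x i) * (1 / sqrt (x i))) - (\<Sum>i=1..K. (y i - x i) * (1 / sqrt (z i)))"
    using breg_diff[OF z x' y] breg_eq[OF x y] by linarith
  then have "\<sigma> * (breg K y x - breg K y z + breg K x z)
      = (\<Sum>i=1..K. (y i - x i) * (\<sigma> * (1 / sqrt (x i)))) - (\<Sum>i=1..K. (y i - x i) * (\<sigma> * (1 / sqrt (z i))))"
    by (simp only: right_diff_distrib[of \<sigma>] sum_distrib_left mult.left_commute[of \<sigma>])
  also have "(\<Sum>i=1..K. (y i - x i) * (\<sigma> * (1 / sqrt (z i))))
      = (\<Sum>i=1..K. (y i - x i) * c + (y i - x i) * (\<sigma> * (1 / sqrt (x i))) - g i * (x i - y i))"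
    by (intro sum.cong refl) (simp only: stationary, simp only: algebra_simps)
  also have "\<dots> = (\<Sum>i=1..K. (y i - x i) * (\<sigma> * (1 / sqrt (x i)))) - (\<Sum>i=1..K. g i * (x i - y i))"
    by (simp only: sum.distrib sum_subtractf sum_simplex_diff_const[OF x' y])
  finally show ?thesis by simp
qed

text \<open>Apply \<open>2 u v \<le> u^2 + v^2\<close> to \<open>\<sigma> (p - q)\<close> and
  \<open>a p^2\<close>, divide by \<open>\<sigma> p\<close>, and drop the nonnegative part
  \<open>a (p - q)^2\<close>.\<close>

lemma stability_scalar:
  fixes a p q \<sigma> :: real
  assumes "0 \<le> a" "0 < p" "0 < \<sigma>"
  shows "a * (p\<^sup>2 - q\<^sup>2) \<le> \<sigma> * ((q - p)\<^sup>2 / p) + a\<^sup>2 * p ^ 3 / \<sigma>"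
proof -
  have "2 * a * (p * (p - q)) * (\<sigma> * p) \<le> (\<sigma> * (p - q))\<^sup>2 + (a * p\<^sup>2)\<^sup>2"
    using sum_squares_bound[of "\<sigma> * (p - q)" "a * p\<^sup>2"]
    by (simp add: power2_eq_square mult_ac)
  then have "2 * a * (p * (p - q)) \<le> ((\<sigma> * (p - q))\<^sup>2 + (a * p\<^sup>2)\<^sup>2) / (\<sigma> * p)"
    using assms by (subst pos_le_divide_eq) auto
  also have "\<dots> = \<sigma> * ((q - p)\<^sup>2 / p) + a\<^sup>2 * p ^ 3 / \<sigma>"
    using assms by (simp add: field_simps power2_eq_square power3_eq_cube)
  finally have "2 * a * (p * (p - q)) \<le> \<sigma> * ((q - p)\<^sup>2 / p) + a\<^sup>2 * p ^ 3 / \<sigma>" .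
  moreover have "a * (p\<^sup>2 - q\<^sup>2) = 2 * a * (p * (p - q)) - a * (p - q)\<^sup>2"
    by (simp add: power2_eq_square algebra_simps)
  moreover have "0 \<le> a * (p - q)\<^sup>2" using assms by simp
  ultimately show ?thesis by linarith
qed

text \<open>The mirror step tested at \<open>y = z\<close> gives the symmetrized divergence. Only
  coordinate \<open>k\<close> of \<open>g\<close> survives, and the \<open>k\<close>-th term of
  \<open>breg K z x\<close> absorbs the quadratic part of \<open>stability_scalar\<close>.\<close>

lemma stability_le:
  assumes x: "x \<in> pos_simplex K" and z: "z \<in> pos_simplex K" and "0 < \<sigma>"
    and k: "k \<in> {1..K}" "0 \<le> g k" "\<And>i. i \<noteq> k \<Longrightarrow> g i = 0"
    and stationary: "\<And>i. i \<in> {1..K} \<Longrightarrow> \<sigma> * (1 / sqrt (z i)) = c + \<sigma> * (1 / sqrt (x i)) + g i"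
  shows "\<sigma> * breg K x z \<le> (g k)\<^sup>2 * sqrt (x k) ^ 3 / \<sigma>"
proof -
  have pos: "0 < x i" "0 < z i" if "i \<in> {1..K}" for i using x z that by (auto simp: pos_simplex_def)
  have "(\<Sum>i=1..K. g i * (x i - z i)) = (\<Sum>i\<in>{k}. g i * (x i - z i))"
    using k by (intro sum.mono_neutral_right) auto
  then have "g k * (x k - z k) = \<sigma> * breg K z x + \<sigma> * breg K x z"
    using mirror_step_eq[OF x z pos_simplex_imp_prob_simplex[OF z] stationary]
    by (simp add: breg_self distrib_left)
  moreover have "(sqrt (z k) - sqrt (x k))\<^sup>2 / sqrt (x k) \<le> breg K z x"
    unfolding breg_def using k(1) pos by (intro member_le_sum) (auto simp: less_imp_le)
  then have "\<sigma> * ((sqrt (z k) - sqrt (x k))\<^sup>2 / sqrt (x k)) \<le> \<sigma> * breg K z x"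
    using assms(3) by (intro mult_left_mono) auto
  moreover have "g k * ((sqrt (x k))\<^sup>2 - (sqrt (z k))\<^sup>2)
      \<le> \<sigma> * ((sqrt (z k) - sqrt (x k))\<^sup>2 / sqrt (x k)) + (g k)\<^sup>2 * sqrt (x k) ^ 3 / \<sigma>"
    using pos[OF k(1)] assms(3) k(2) by (intro stability_scalar) auto
  ultimately show ?thesis using pos[OF k(1)] by simp
qed

lemma uniform_vec_pos_simplex: "1 \<le> K \<Longrightarrow> uniform_vec K \<in> pos_simplex K"
  by (auto simp: uniform_vec_def pos_simplex_def prob_simplex_def vecs_def)

definition vertex :: "nat \<Rightarrow> rvec" where
  "vertex k = (\<lambda>i. if i = k then 1 else 0)"

lemma vertex_prob_simplex: "k \<in> {1..K} \<Longrightarrow> vertex k \<in> prob_simplex K"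
  by (auto simp: vertex_def prob_simplex_def vecs_def)

text \<open>\<open>Psi\<close> has a constant gradient at the uniform point, so the linear term
  vanishes and the divergence is \<open>2 * sqrt K - 2\<close>.\<close>

lemma breg_vertex_uniform_le:
  assumes "k \<in> {1..K}"
  shows "breg K (vertex k) (uniform_vec K) \<le> 2 * sqrt (real K)"
proof -
  have K: "1 \<le> K" using assms by auto
  have "Psi K (vertex k) = - 2"
  proof -
    have "(\<Sum>i=1..K. sqrt (vertex k i)) = (\<Sum>i=1..K. if i = k then 1 else 0)"
      by (intro sum.cong) (auto simp: vertex_def)
    then show ?thesis using assms by (simp add: Psi_def)
  qed
  moreover have "Psi K (uniform_vec K) = - 2 * sqrt (real K)"
    using K by (simp add: Psi_def uniform_vec_def real_sqrt_divide real_div_sqrt)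
  moreover have "(\<Sum>i=1..K. (vertex k i - uniform_vec K i) * (1 / sqrt (uniform_vec K i))) = 
     (\<Sum>i=1..K. (vertex k i - uniform_vec K i) * sqrt (real K))"
    by (intro sum.cong) (auto simp: uniform_vec_def real_sqrt_divide)
  moreover have "\<dots> = 0"
    by (rule sum_simplex_diff_const[OF pos_simplex_imp_prob_simplex[OF uniform_vec_pos_simplex[OF K]] vertex_prob_simplex[OF assms]])
  ultimately show ?thesis
    using breg_eq[OF uniform_vec_pos_simplex[OF K] vertex_prob_simplex[OF assms]] by simp
qed

section \<open>Mirror descent with vaults along a fixed arm sequence\<close>

context
  fixes K :: nat and l :: "nat \<Rightarrow> nat \<Rightarrow> real" and d :: "nat \<Rightarrow> nat" and A :: "nat \<Rightarrow> nat"
  assumes K: "1 \<le> K"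
begin

abbreviation "play \<equiv> play_dist K l d A"
abbreviation "post s \<equiv> post_dist K l d A s (play s)"

lemma play_dist_pos_simplex: "play t \<in> pos_simplex K"
  by (subst play_dist.simps) (rule grad_conj_Psi_pos_simplex[OF K])

lemma post_dist_pos_simplex: "post t \<in> pos_simplex K"
  unfolding post_dist_def by (rule grad_conj_Psi_pos_simplex[OF K])

lemma grad_Psi_pos_simplex:
  "x \<in> pos_simplex K \<Longrightarrow> i \<in> {1..K} \<Longrightarrow> grad K (Psi K) x i = - (1 / sqrt (x i))"
  by (subst grad_Psi) (auto simp: pos_simplex_def)

lemma post_dist_stationary:
  "\<exists>c. \<forall>i\<in>{1..K}. sigma l d A t * (1 / sqrt (post t i)) =
    c + sigma l d A t * (1 / sqrt (play t i)) + loss_est l d A t (play t) i"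
proof -
  let ?\<sigma> = "sigma l d A t"
  have \<sigma>: "0 < ?\<sigma>" by (rule sigma_pos)
  have "\<exists>c. \<forall>i\<in>{1..K}. 1 / sqrt (post t i) = c - (grad K (Psi K) (play t) i - 1 / ?\<sigma> * loss_est l d A t (play t) i)"
    unfolding post_dist_def by (rule grad_conj_Psi_stationary[OF K])
  then obtain c where c: "\<And>i. i \<in> {1..K} \<Longrightarrow> 1 / sqrt (post t i) =
      c - (grad K (Psi K) (play t) i - 1 / ?\<sigma> * loss_est l d A t (play t) i)" by blast
  show ?thesis
  proof (intro exI[of _ "?\<sigma> * c"] ballI)
    fix i assume i: "i \<in> {1..K}"
    show "?\<sigma> * (1 / sqrt (post t i)) = ?\<sigma> * c + ?\<sigma> * (1 / sqrt (play t i)) + loss_est l d A t (play t) i"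
      unfolding c[OF i] grad_Psi_pos_simplex[OF play_dist_pos_simplex i]
      using \<sigma> by (simp add: field_simps)
  qed
qed

lemma play_dist_stationary:
  "\<exists>c. \<forall>i\<in>{1..K}. sigma l d A t * (1 / sqrt (play t i)) =
    c + (\<Sum>s\<in>{1..<t}. sigma2 l d A t s * (1 / sqrt (post s i))) + invest l d A t * (1 / sqrt (uniform_vec K i))"
proof -
  let ?\<sigma> = "sigma l d A t"
  have \<sigma>: "0 < ?\<sigma>" by (rule sigma_pos)
  let ?y = "\<lambda>i. 1 / ?\<sigma> * (\<Sum>s\<in>{1..<t}. sigma2 l d A t s * grad K (Psi K) (post s) i)
     + invest l d A t / ?\<sigma> * grad K (Psi K) (uniform_vec K) i"
  have "play t = grad_conj K (Psi K) ?y" by (rule play_dist.simps)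
  then have "\<exists>c. \<forall>i\<in>{1..K}. 1 / sqrt (play t i) = c - ?y i"
    using grad_conj_Psi_stationary[OF K, of ?y] by simp
  then obtain c where c: "\<And>i. i \<in> {1..K} \<Longrightarrow> 1 / sqrt (play t i) = c - ?y i" by blast
  show ?thesis
  proof (intro exI[of _ "?\<sigma> * c"] ballI)
    fix i assume i: "i \<in> {1..K}"
    show "?\<sigma> * (1 / sqrt (play t i)) = ?\<sigma> * c + (\<Sum>s\<in>{1..<t}. sigma2 l d A t s * (1 / sqrt (post s i)))
        + invest l d A t * (1 / sqrt (uniform_vec K i))"
    proof -
      define S u where "S = (\<Sum>s\<in>{1..<t}. sigma2 l d A t s * (1 / sqrt (post s i)))"
        and "u = 1 / sqrt (uniform_vec K i)"
      have S: "(\<Sum>s\<in>{1..<t}. sigma2 l d A t s * grad K (Psi K) (post s) i) = - S"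
        unfolding grad_Psi_pos_simplex[OF post_dist_pos_simplex i] S_def
        by (simp only: mult_minus_right sum_negf)
      show ?thesis
        unfolding c[OF i] S grad_Psi_pos_simplex[OF uniform_vec_pos_simplex[OF K] i]
          S_def[symmetric] u_def[symmetric]
        using \<sigma> by (simp add: field_simps)
    qed
  qed
qed

text \<open>The bound of \<open>stability_le\<close> for an importance-weighted loss:
  \<open>(l / x)^2 * sqrt x ^ 3 / sigma\<close> simplifies to \<open>l^2 / (sigma * sqrt x)\<close>.
  A skipped round has a zero estimate.\<close>

definition stability :: "nat \<Rightarrow> real" where
  "stability t = (if Lhat l d A t < l t (A t) then 0
     else (l t (A t))\<^sup>2 / (sigma l d A t * sqrt (play t (A t))))"

lemma loss_est_stability_le:
  assumes "A t \<in> {1..K}" "0 \<le> l t (A t)"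
  shows "sigma l d A t * breg K (play t) (post t) \<le> stability t"
proof -
  have x: "0 < play t (A t)" using play_dist_pos_simplex[of t] assms(1) by (auto simp: pos_simplex_def)
  obtain c where c: "\<And>i. i \<in> {1..K} \<Longrightarrow> sigma l d A t * (1 / sqrt (post t i)) =
    c + sigma l d A t * (1 / sqrt (play t i)) + loss_est l d A t (play t) i"
    using post_dist_stationary[of t] by blast
  have "sigma l d A t * breg K (play t) (post t)
      \<le> (loss_est l d A t (play t) (A t))\<^sup>2 * sqrt (play t (A t)) ^ 3 / sigma l d A t"
    by (rule stability_le[OF play_dist_pos_simplex post_dist_pos_simplex sigma_pos assms(1) _ _ c])
      (use assms(2) x in \<open>auto simp: loss_est_def\<close>)
  also have "\<dots> = stability t"
  proof -
    define p where "p = sqrt (play t (A t))"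
    have p: "0 < p" "play t (A t) = p * p" using x by (auto simp: p_def)
    show ?thesis using p(1) sigma_pos[of l d A t]
      unfolding stability_def loss_est_def p_def[symmetric] p(2)
      by (auto simp: field_simps power2_eq_square power3_eq_cube)
  qed
  finally show ?thesis .
qed

text \<open>The vault balances weight a potential: withdrawing from account \<open>s\<close> pays for the Bregman
  divergence to \<open>x\<^sub>t\<close> with the divergence to \<open>z\<^sub>s\<close>, and round \<open>t\<close> deposits the divergence to \<open>z\<^sub>t\<close>.\<close>

lemma linearized_regret_potential:
  assumes y: "y \<in> prob_simplex K"
    and A: "\<And>t. t \<in> {1..n} \<Longrightarrow> A t \<in> {1..K}" "\<And>t. t \<in> {1..n} \<Longrightarrow> 0 \<le> l t (A t)"
  shows "(\<Sum>t=1..n. \<Sum>i=1..K. loss_est l d A t (play t) i * (play t i - y i))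
      + (\<Sum>s=1..n. vault l d A n s * breg K y (post s))
    \<le> (\<Sum>t=1..n. invest l d A t) * breg K y (uniform_vec K) + (\<Sum>t=1..n. stability t)"
  using A
proof (induction n)
  case (Suc n)
  let ?t = "Suc n"
  let ?\<sigma> = "sigma l d A ?t"
  obtain c where c: "\<And>i. i \<in> {1..K} \<Longrightarrow> ?\<sigma> * (1 / sqrt (play ?t i)) =
    c + (\<Sum>s\<in>{1..<?t}. sigma2 l d A ?t s * (1 / sqrt (post s i))) + invest l d A ?t * (1 / sqrt (uniform_vec K i))"
    using play_dist_stationary[of ?t] by blast
  have "?\<sigma> * breg K y (play ?t) \<le> (\<Sum>s\<in>{1..<?t}. sigma2 l d A ?t s * breg K y (post s))
      + invest l d A ?t * breg K y (uniform_vec K)"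
  proof (rule breg_barycenter_le[OF play_dist_pos_simplex y uniform_vec_pos_simplex[OF K] post_dist_pos_simplex _ _ _ c])
    show "?\<sigma> = sum (sigma2 l d A ?t) {1..<?t} + invest l d A ?t"
      using sum_sigma2[of l d A n] by (simp add: atLeastLessThanSuc_atLeastAtMost)
  qed (auto simp: sigma2_nonneg invest_nonneg)
  then have bary: "?\<sigma> * breg K y (play ?t) \<le> (\<Sum>s=1..n. sigma2 l d A ?t s * breg K y (post s))
      + invest l d A ?t * breg K y (uniform_vec K)"
    by (simp add: atLeastLessThanSuc_atLeastAtMost)
  obtain c' where c': "\<And>i. i \<in> {1..K} \<Longrightarrow> ?\<sigma> * (1 / sqrt (post ?t i)) =
    c' + ?\<sigma> * (1 / sqrt (play ?t i)) + loss_est l d A ?t (play ?t) i"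
    using post_dist_stationary[of ?t] by blast
  have step: "(\<Sum>i=1..K. loss_est l d A ?t (play ?t) i * (play ?t i - y i))
      = ?\<sigma> * (breg K y (play ?t) - breg K y (post ?t) + breg K (play ?t) (post ?t))"
    by (rule mirror_step_eq[OF play_dist_pos_simplex post_dist_pos_simplex y c'])
  have stab: "?\<sigma> * breg K (play ?t) (post ?t) \<le> stability ?t"
    using Suc.prems[of ?t] by (intro loss_est_stability_le) auto
  have "(\<Sum>s=1..n. vault l d A ?t s * breg K y (post s))
      = (\<Sum>s=1..n. (vault l d A n s - sigma2 l d A ?t s) * breg K y (post s))"
    by (intro sum.cong) (auto simp: vault_Suc simp del: vault.simps)
  then have pot: "(\<Sum>s=1..?t. vault l d A ?t s * breg K y (post s)) =
      (\<Sum>s=1..n. vault l d A n s * breg K y (post s))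
      - (\<Sum>s=1..n. sigma2 l d A ?t s * breg K y (post s)) + ?\<sigma> * breg K y (post ?t)"
    by (simp add: left_diff_distrib sum_subtractf)
  have "(\<Sum>t=1..n. \<Sum>i=1..K. loss_est l d A t (play t) i * (play t i - y i))
      + (\<Sum>s=1..n. vault l d A n s * breg K y (post s))
    \<le> (\<Sum>t=1..n. invest l d A t) * breg K y (uniform_vec K) + (\<Sum>t=1..n. stability t)"
    using Suc.prems by (intro Suc.IH) auto
  moreover have "(\<Sum>i=1..K. loss_est l d A ?t (play ?t) i * (play ?t i - y i))
      = ?\<sigma> * breg K y (play ?t) - ?\<sigma> * breg K y (post ?t) + ?\<sigma> * breg K (play ?t) (post ?t)"
    unfolding step by (simp only: distrib_left right_diff_distrib)
  moreover have "(\<Sum>t=1..?t. invest l d A t) * breg K y (uniform_vec K)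
      = (\<Sum>t=1..n. invest l d A t) * breg K y (uniform_vec K) + invest l d A ?t * breg K y (uniform_vec K)"
    by (simp add: distrib_right)
  moreover have "(\<Sum>t=1..?t. \<Sum>i=1..K. loss_est l d A t (play t) i * (play t i - y i))
      = (\<Sum>t=1..n. \<Sum>i=1..K. loss_est l d A t (play t) i * (play t i - y i))
        + (\<Sum>i=1..K. loss_est l d A ?t (play ?t) i * (play ?t i - y i))" by simp
  moreover have "(\<Sum>t=1..?t. stability t) = (\<Sum>t=1..n. stability t) + stability ?t" by simp
  ultimately show ?case
    using bary stab pot by linarith
qed simp

lemma linearized_regret_le:
  assumes "k \<in> {1..K}"
    and A: "\<And>t. t \<in> {1..n} \<Longrightarrow> A t \<in> {1..K}" "\<And>t. t \<in> {1..n} \<Longrightarrow> 0 \<le> l t (A t)"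
  shows "(\<Sum>t=1..n. \<Sum>i=1..K. loss_est l d A t (play t) i * (play t i - vertex k i))
    \<le> (\<Sum>t=1..n. invest l d A t) * (2 * sqrt (real K)) + (\<Sum>t=1..n. stability t)"
proof -
  \<comment> \<open>The potential left at the end is nonnegative and can be discarded.\<close>
  have "0 \<le> (\<Sum>s=1..n. vault l d A n s * breg K (vertex k) (post s))"
    using vault_nonneg breg_nonneg[OF pos_simplex_imp_prob_simplex[OF post_dist_pos_simplex]]
    by (intro sum_nonneg mult_nonneg_nonneg) auto
  moreover have "(\<Sum>t=1..n. invest l d A t) * breg K (vertex k) (uniform_vec K)
      \<le> (\<Sum>t=1..n. invest l d A t) * (2 * sqrt (real K))"
    using breg_vertex_uniform_le[OF assms(1)] invest_nonneg
    by (intro mult_left_mono sum_nonneg) auto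
  ultimately show ?thesis
    using linearized_regret_potential[OF vertex_prob_simplex[OF assms(1)], of n] A by fastforce
qed

end

section \<open>Expectations\<close>

lemma Lhat_cong:
  assumes "\<And>s. s \<in> {1..<t} \<Longrightarrow> A s = A' s"
  shows "Lhat l d A t = Lhat l d A' t"
  using assms
proof (induction t)
  case (Suc t)
  then have "Lhat l d A t = Lhat l d A' t" by simp
  moreover have "{2 * l s (A s) |s. s \<in> {1..t} \<and> s + d s = t} = {2 * l s (A' s) |s. s \<in> {1..t} \<and> s + d s = t}"
  proof -
    have eq: "A s = A' s" if "s \<in> {1..t}" for s using Suc.prems that by simp
    show ?thesis by (intro Collect_cong ex_cong1) (metis eq)
  qed
  ultimately show ?case by simp
qed simp

text \<open>Whether a feedback is missing is decided by the delays alone, so no agreement of the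
  arms is required.\<close>

lemma num_missing_cong: "num_missing l d A t = num_missing l d A' t"
  unfolding num_missing_eq ..

lemma cumD_cong:
  assumes "\<And>s. s \<in> {1..<t} \<Longrightarrow> A s = A' s"
  shows "cumD l d A t = cumD l d A' t"
  unfolding cumD_def
proof (intro sum.cong refl)
  fix s assume "s \<in> {1..t}"
  then have "Lhat l d A s = Lhat l d A' s" using assms by (intro Lhat_cong) auto
  then show "(real (num_missing l d A s) + 1) * (Lhat l d A s)\<^sup>2 = (real (num_missing l d A' s) + 1) * (Lhat l d A' s)\<^sup>2"
    using num_missing_cong[of l d A s A'] by simp
qed

lemma sigma_cong:
  assumes "\<And>s. s \<in> {1..<t} \<Longrightarrow> A s = A' s"
  shows "sigma l d A t = sigma l d A' t"
proof -
  have "cumD l d A t = cumD l d A' t" "Lhat l d A t = Lhat l d A' t"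
    using assms by (auto intro!: cumD_cong Lhat_cong)
  then show ?thesis unfolding sigma_def num_missing_cong[of l d A t A'] by simp
qed

lemma usable_cong:
  assumes "\<And>s. s \<in> {1..<t} \<Longrightarrow> A s = A' s"
  shows "usable l d A t = usable l d A' t"
proof
  fix s
  have "Lhat l d A s = Lhat l d A' s" "A s = A' s" if "s \<in> {1..<t}"
    using assms that by (auto intro!: Lhat_cong)
  then show "usable l d A t s = usable l d A' t s" by (auto simp: usable_iff)
qed

lemma vault_cong:
  assumes "\<And>s. s \<in> {1..<t} \<Longrightarrow> A s = A' s"
  shows "vault l d A t = vault l d A' t"
  using assms
proof (induction t)
  case (Suc t)
  then have "vault l d A t = vault l d A' t" by simp
  moreover have "sigma l d A (Suc t) = sigma l d A' (Suc t)" "usable l d A (Suc t) = usable l d A' (Suc t)"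
    using Suc.prems by (intro sigma_cong usable_cong; simp)+
  ultimately show ?case by (simp only: vault.simps)
qed simp

lemma sigma2_cong:
  assumes "\<And>s. s \<in> {1..<t} \<Longrightarrow> A s = A' s"
  shows "sigma2 l d A t s = sigma2 l d A' t s" "invest l d A t = invest l d A' t"
proof -
  have "vault l d A (t - 1) = vault l d A' (t - 1)" using assms by (intro vault_cong) auto
  moreover have "sigma l d A t = sigma l d A' t" "usable l d A t = usable l d A' t"
    using assms by (intro sigma_cong usable_cong; simp)+
  ultimately show "sigma2 l d A t s = sigma2 l d A' t s" "invest l d A t = invest l d A' t"
    by (simp_all only: sigma2_def invest_def)
qed

lemma post_dist_cong:
  assumes "\<And>r. r \<in> {1..<t} \<Longrightarrow> A r = A' r" "s \<in> {1..<t}"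
  shows "post_dist K l d A s = post_dist K l d A' s"
proof -
  have "sigma l d A s = sigma l d A' s" "Lhat l d A s = Lhat l d A' s" "A s = A' s"
    using assms by (auto intro!: sigma_cong Lhat_cong)
  then show ?thesis by (intro ext) (simp only: post_dist_def loss_est_def)
qed

lemma play_dist_cong:
  assumes "\<And>s. s \<in> {1..<t} \<Longrightarrow> A s = A' s"
  shows "play_dist K l d A t = play_dist K l d A' t"
  using assms
proof (induction t rule: less_induct)
  case (less t)
  have "post_dist K l d A s (play_dist K l d A s) = post_dist K l d A' s (play_dist K l d A' s)"
    if "s \<in> {1..<t}" for s
  proof -
    have "play_dist K l d A s = play_dist K l d A' s"
      using that less.prems by (intro less.IH) auto
    then show ?thesis using post_dist_cong[of t A A' s K l d] less.prems that by simp
  qed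
  then have "(\<Sum>s\<in>{1..<t}. sigma2 l d A t s * grad K (Psi K) (post_dist K l d A s (play_dist K l d A s)) i) =
     (\<Sum>s\<in>{1..<t}. sigma2 l d A' t s * grad K (Psi K) (post_dist K l d A' s (play_dist K l d A' s)) i)" for i
    using sigma2_cong(1)[of t A A' l d] less.prems by (intro sum.cong) auto
  moreover have "sigma l d A t = sigma l d A' t" "invest l d A t = invest l d A' t"
    using less.prems by (auto intro!: sigma_cong sigma2_cong(2))
  ultimately show ?case
    by (simp only: play_dist.simps[of K l d A t] play_dist.simps[of K l d A' t])
qed

section \<open>The joint law of the arms and conditional expectations\<close>

lemma pmf_embed_simplex:
  assumes "x \<in> prob_simplex K"
  shows "pmf (embed_pmf x) i = x i" "set_pmf (embed_pmf x) \<subseteq> {1..K}"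
proof -
  have zero: "x j = 0" if "j \<notin> {1..K}" for j
    using assms that unfolding prob_simplex_def vecs_def by blast
  have nonneg: "0 \<le> x j" for j
    using assms zero[of j] unfolding prob_simplex_def by (cases "j \<in> {1..K}") simp_all
  have pmf: "pmf (embed_pmf x) j = x j" for j
  proof (rule pmf_embed_pmf)
    have "(\<integral>\<^sup>+ j. ennreal (x j) \<partial>count_space UNIV) = (\<integral>\<^sup>+ j. ennreal (x j) \<partial>count_space {1..K})"
      using zero by (subst nn_integral_count_space_indicator)
        (auto intro!: nn_integral_cong simp: indicator_def simp del: atLeastAtMost_iff)
    also have "\<dots> = (\<Sum>j=1..K. ennreal (x j))" by (rule nn_integral_count_space_finite) simp
    also have "\<dots> = ennreal (\<Sum>j=1..K. x j)" using nonneg by (intro sum_ennreal) auto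
    also have "\<dots> = 1" using assms by (simp add: prob_simplex_def)
    finally show "(\<integral>\<^sup>+ j. ennreal (x j) \<partial>count_space UNIV) = 1" .
  qed (rule nonneg)
  show "pmf (embed_pmf x) i = x i" by (rule pmf)
  show "set_pmf (embed_pmf x) \<subseteq> {1..K}"
    using zero pmf by (metis set_pmf_iff subsetI)
qed

context
  fixes K :: nat and l :: "nat \<Rightarrow> nat \<Rightarrow> real" and d :: "nat \<Rightarrow> nat"
  assumes K: "1 \<le> K"
begin

lemma play_dist_prob_simplex: "play_dist K l d A t \<in> prob_simplex K"
  by (rule pos_simplex_imp_prob_simplex[OF play_dist_pos_simplex[OF K]])

lemma set_actions:
  "A \<in> set_pmf (actions K l d n) \<Longrightarrow> t \<in> {1..n} \<Longrightarrow> A t \<in> {1..K}"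
proof (induction n arbitrary: A)
  case (Suc n)
  then obtain A0 i where "A0 \<in> set_pmf (actions K l d n)"
    "i \<in> set_pmf (embed_pmf (play_dist K l d A0 (Suc n)))" "A = A0(Suc n := i)"
    by auto
  then show ?case
    using Suc.IH[of A0] Suc.prems(2) pmf_embed_simplex(2)[OF play_dist_prob_simplex[of A0 "Suc n"]]
    by (cases "t = Suc n") auto
qed simp

lemma finite_set_embed: "finite (set_pmf (embed_pmf (play_dist K l d A t)))"
  by (rule finite_subset[OF pmf_embed_simplex(2)[OF play_dist_prob_simplex]]) simp

lemma finite_set_actions: "finite (set_pmf (actions K l d n))"
  by (induction n) (auto simp: finite_set_embed)

lemma integrable_actions: "integrable (measure_pmf (actions K l d n)) (f :: _ \<Rightarrow> real)"
  by (rule integrable_measure_pmf_finite[OF finite_set_actions])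

text \<open>Tower rule for the last round; finite supports reduce every expectation to a finite
  sum.\<close>

lemma expectation_actions_Suc:
  fixes F :: "(nat \<Rightarrow> nat) \<Rightarrow> real"
  shows "measure_pmf.expectation (actions K l d (Suc n)) F =
    measure_pmf.expectation (actions K l d n)
      (\<lambda>A. \<Sum>i=1..K. play_dist K l d A (Suc n) i * F (A(Suc n := i)))"
proof -
  have inner: "measure_pmf.expectation (map_pmf (\<lambda>i. A(Suc n := i)) (embed_pmf (play_dist K l d A (Suc n)))) F
      = (\<Sum>i=1..K. play_dist K l d A (Suc n) i * F (A(Suc n := i)))" for A
  proof -
    have "measure_pmf.expectation (embed_pmf (play_dist K l d A (Suc n))) (\<lambda>i. F (A(Suc n := i)))
        = (\<Sum>i=1..K. pmf (embed_pmf (play_dist K l d A (Suc n))) i *\<^sub>R F (A(Suc n := i)))"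
      using pmf_embed_simplex(2)[OF play_dist_prob_simplex[of A "Suc n"]]
      by (intro integral_measure_pmf) auto
    then show ?thesis by (simp add: pmf_embed_simplex(1)[OF play_dist_prob_simplex])
  qed
  have "measure_pmf.expectation (actions K l d (Suc n)) F =
      (\<Sum>A\<in>set_pmf (actions K l d n). pmf (actions K l d n) A *\<^sub>R
        measure_pmf.expectation (map_pmf (\<lambda>i. A(Suc n := i)) (embed_pmf (play_dist K l d A (Suc n)))) F)"
    unfolding actions.simps
    by (rule pmf_expectation_bind) (auto simp: finite_set_actions finite_set_embed)
  also have "\<dots> = measure_pmf.expectation (actions K l d n)
      (\<lambda>A. \<Sum>i=1..K. play_dist K l d A (Suc n) i * F (A(Suc n := i)))"
    unfolding inner by (rule integral_measure_pmf[symmetric]) (auto simp: finite_set_actions)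
  finally show ?thesis .
qed

lemma loss_est_inner:
  assumes "A t \<in> {1..K}"
  shows "(\<Sum>i=1..K. loss_est l d A t x i * w i)
    = (if Lhat l d A t < l t (A t) then 0 else l t (A t) / x (A t) * w (A t))"
proof -
  have "(\<Sum>i=1..K. loss_est l d A t x i * w i) = (\<Sum>i\<in>{A t}. loss_est l d A t x i * w i)"
    using assms by (intro sum.mono_neutral_right) (auto simp: loss_est_def)
  then show ?thesis by (simp add: loss_est_def)
qed

text \<open>The part of the regret of round \<open>t\<close> against arm \<open>k\<close> that is not controlled pathwise;
  its conditional expectation given the past is nonpositive.\<close>

definition excess :: "nat \<Rightarrow> (nat \<Rightarrow> nat) \<Rightarrow> nat \<Rightarrow> real" where
  "excess k A t = l t (A t) - l t k
     - (\<Sum>i=1..K. loss_est l d A t (play_dist K l d A t) i * (play_dist K l d A t i - vertex k i))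
     - (if Lhat l d A t < l t (A t) then l t (A t) else 0)
     + stability K l d A t - sqrt (real K) * ((Lhat l d A t)\<^sup>2 / sigma l d A t)"

lemma excess_cong:
  assumes "\<And>s. s \<in> {1..t} \<Longrightarrow> A s = A' s" "1 \<le> t"
  shows "excess k A t = excess k A' t"
proof -
  have "A t = A' t" "\<And>s. s \<in> {1..<t} \<Longrightarrow> A s = A' s" using assms by auto
  then show ?thesis
    using Lhat_cong[of t A A' l d] sigma_cong[of t A A' l d] play_dist_cong[of t A A' K l d]
    by (simp only: excess_def stability_def[OF K] loss_est_def)
qed

text \<open>The importance-weighted losses of unskipped arms are unbiased, so losses and estimates
  cancel; a skipped arm is paid by its own term, and leaving out its comparator part only helps
  because losses are nonnegative. The stability terms average to at most
  \<open>sqrt (x j) * (Lt^2 / \<sigma>)\<close> per arm.\<close>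

lemma excess_conditional_expectation:
  assumes "\<And>i. i \<in> {1..K} \<Longrightarrow> 0 \<le> l t i" "k \<in> {1..K}"
  shows "(\<Sum>j=1..K. play_dist K l d A t j * excess k (A(t := j)) t) \<le> 0"
proof -
  define x where "x = play_dist K l d A t"
  define Lt where "Lt = Lhat l d A t"
  define \<sigma> where "\<sigma> = sigma l d A t"
  have \<sigma>: "0 < \<sigma>" by (simp add: \<sigma>_def sigma_pos)
  have x: "x \<in> pos_simplex K" using play_dist_pos_simplex[OF K] by (simp add: x_def)
  have xpos: "0 < x j" if "j \<in> {1..K}" for j using x that by (auto simp: pos_simplex_def)
  have sum1: "(\<Sum>j=1..K. x j) = 1" using x by (simp add: pos_simplex_def prob_simplex_def)
  \<comment> \<open>Redrawing the arm of round \<open>t\<close> changes none of the quantities fixed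
    before the draw.\<close>
  have eqs: "play_dist K l d (A(t := j)) t = x" "Lhat l d (A(t := j)) t = Lt" "sigma l d (A(t := j)) t = \<sigma>" for j
    unfolding x_def Lt_def \<sigma>_def by (auto intro!: play_dist_cong Lhat_cong sigma_cong)
  have bound: "x j * excess k (A(t := j)) t \<le> (if j = k then l t k else 0) - x j * l t k
      + sqrt (x j) * (Lt\<^sup>2 / \<sigma>) - x j * (sqrt (real K) * (Lt\<^sup>2 / \<sigma>))" if j: "j \<in> {1..K}" for j
  proof -
    have ex: "excess k (A(t := j)) t = l t j - l t k
     - (if Lt < l t j then 0 else l t j / x j * (x j - vertex k j))
     - (if Lt < l t j then l t j else 0)
     + (if Lt < l t j then 0 else (l t j)\<^sup>2 / (\<sigma> * sqrt (x j))) - sqrt (real K) * (Lt\<^sup>2 / \<sigma>)"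
    proof -
      have A: "(A(t := j)) t = j" by simp
      have "(A(t := j)) t \<in> {1..K}" using j by simp
      note inner = loss_est_inner[where A = "A(t := j)" and t = t, OF this, unfolded eqs A]
      show ?thesis unfolding excess_def stability_def[OF K] eqs A inner ..
    qed
    show ?thesis
    proof (cases "Lt < l t j")
      case True
      have "0 \<le> sqrt (x j) * (Lt\<^sup>2 / \<sigma>)" using xpos[OF j] \<sigma> by simp
      moreover have "0 \<le> (if j = k then l t k else 0)" using assms by auto
      ultimately show ?thesis using True unfolding ex by (simp add: algebra_simps)
    next
      case False
      have "(l t j)\<^sup>2 \<le> Lt\<^sup>2" using False assms(1)[OF j] by (intro power_mono) auto
      then have "sqrt (x j) * ((l t j)\<^sup>2 / \<sigma>) \<le> sqrt (x j) * (Lt\<^sup>2 / \<sigma>)"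
        using xpos[OF j] \<sigma> by (intro mult_left_mono divide_right_mono) auto
      moreover have "x j * ((l t j)\<^sup>2 / (\<sigma> * sqrt (x j))) = sqrt (x j) * ((l t j)\<^sup>2 / \<sigma>)"
      proof -
        define p where "p = sqrt (x j)"
        have "0 < p" "x j = p * p" using xpos[OF j] by (auto simp: p_def)
        then show ?thesis unfolding p_def[symmetric] by (simp add: \<open>x j = p * p\<close>)
      qed
      moreover have "x j * (l t j / x j * (x j - vertex k j)) = x j * l t j - (if j = k then l t k else 0)"
        using xpos[OF j] by (auto simp: vertex_def field_simps)
      ultimately show ?thesis
        using False unfolding ex by (simp only: if_False right_diff_distrib distrib_left)
    qed
  qed
  have "(\<Sum>j=1..K. x j * excess k (A(t := j)) t) \<le> (\<Sum>j=1..K. (if j = k then l t k else 0) - x j * l t k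
      + sqrt (x j) * (Lt\<^sup>2 / \<sigma>) - x j * (sqrt (real K) * (Lt\<^sup>2 / \<sigma>)))"
    by (intro sum_mono bound)
  also have "\<dots> = (\<Sum>j=1..K. if j = k then l t k else 0) - (\<Sum>j=1..K. x j) * l t k
      + (\<Sum>j=1..K. sqrt (x j)) * (Lt\<^sup>2 / \<sigma>) - (\<Sum>j=1..K. x j) * (sqrt (real K) * (Lt\<^sup>2 / \<sigma>))"
    unfolding sum_distrib_right by (simp only: sum.distrib sum_subtractf)
  also have "\<dots> = (\<Sum>j=1..K. sqrt (x j)) * (Lt\<^sup>2 / \<sigma>) - sqrt (real K) * (Lt\<^sup>2 / \<sigma>)"
    unfolding sum1 using assms(2) by simp
  also have "\<dots> \<le> 0"
  proof -
    \<comment> \<open>Cauchy-Schwarz against the all-ones vector.\<close>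
    have "(\<Sum>j=1..K. 1 * sqrt (x j)) \<le> L2_set (\<lambda>_. 1) {1..K} * L2_set (\<lambda>j. sqrt (x j)) {1..K}"
      using L2_set_mult_ineq[of "\<lambda>_. 1" "\<lambda>j. sqrt (x j)" "{1..K}"] xpos
      by (simp add: less_imp_le)
    also have "L2_set (\<lambda>j. sqrt (x j)) {1..K} = 1"
      unfolding L2_set_def using xpos sum1 by (simp add: less_imp_le)
    also have "L2_set (\<lambda>_. 1) {1..K} = sqrt (real K)" by (simp add: L2_set_def)
    finally have "(\<Sum>j=1..K. sqrt (x j)) \<le> sqrt (real K)" by simp
    then have "(\<Sum>j=1..K. sqrt (x j)) * (Lt\<^sup>2 / \<sigma>) \<le> sqrt (real K) * (Lt\<^sup>2 / \<sigma>)"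
      using \<sigma> by (intro mult_right_mono) auto
    then show ?thesis by (simp only: diff_le_0_iff_le)
  qed
  finally show ?thesis by (simp add: x_def)
qed

text \<open>The partial sums of \<open>excess\<close> form a supermartingale: a new arm leaves
  earlier terms unchanged, and its own term has nonpositive conditional mean.\<close>

lemma expectation_sum_excess_le:
  assumes "k \<in> {1..K}" "\<And>t i. t \<in> {1..n} \<Longrightarrow> i \<in> {1..K} \<Longrightarrow> 0 \<le> l t i"
  shows "measure_pmf.expectation (actions K l d n) (\<lambda>A. \<Sum>t=1..n. excess k A t) \<le> 0"
  using assms(2)
proof (induction n)
  case (Suc n)
  let ?E = "measure_pmf.expectation (actions K l d n)"
  have "measure_pmf.expectation (actions K l d (Suc n)) (\<lambda>A. \<Sum>t=1..Suc n. excess k A t)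
      = ?E (\<lambda>A. \<Sum>j=1..K. play_dist K l d A (Suc n) j * (\<Sum>t=1..Suc n. excess k (A(Suc n := j)) t))"
    by (rule expectation_actions_Suc)
  also have "\<dots> \<le> ?E (\<lambda>A. \<Sum>t=1..n. excess k A t)"
  proof (rule integral_mono[OF integrable_actions integrable_actions])
    fix A
    let ?x = "play_dist K l d A (Suc n)"
    have "(\<Sum>t=1..Suc n. excess k (A(Suc n := j)) t)
        = (\<Sum>t=1..n. excess k A t) + excess k (A(Suc n := j)) (Suc n)" for j
    proof -
      have "(\<Sum>t=1..n. excess k (A(Suc n := j)) t) = (\<Sum>t=1..n. excess k A t)"
        by (intro sum.cong refl excess_cong) auto
      then show ?thesis by simp
    qed
    then have "(\<Sum>j=1..K. ?x j * (\<Sum>t=1..Suc n. excess k (A(Suc n := j)) t))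
        = (\<Sum>j=1..K. ?x j) * (\<Sum>t=1..n. excess k A t) + (\<Sum>j=1..K. ?x j * excess k (A(Suc n := j)) (Suc n))"
      by (simp only: distrib_left sum.distrib sum_distrib_right)
    also have "\<dots> \<le> 1 * (\<Sum>t=1..n. excess k A t) + 0"
      using excess_conditional_expectation[of "Suc n" k A] Suc.prems assms(1) play_dist_prob_simplex[of A "Suc n"]
      by (intro add_mono) (auto simp: prob_simplex_def)
    finally show "(\<Sum>j=1..K. ?x j * (\<Sum>t=1..Suc n. excess k (A(Suc n := j)) t)) \<le> (\<Sum>t=1..n. excess k A t)"
      by simp
  qed
  also have "\<dots> \<le> 0" by (intro Suc.IH Suc.prems) auto
  finally show ?case .
qed simp

text \<open>Solves the definition of \<open>excess\<close> for the regret. The stability terms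
  cancel, and \<open>38 = 16 * 2 + 4 + 2\<close> collects investment, skipped losses and the
  compensator of the stability.\<close>

lemma pathwise_regret_le:
  assumes k: "k \<in> {1..K}" and A: "\<And>t. t \<in> {1..n} \<Longrightarrow> A t \<in> {1..K}"
    and l: "\<And>t i. t \<in> {1..n} \<Longrightarrow> i \<in> {1..K} \<Longrightarrow> 0 \<le> l t i \<and> l t i \<le> M"
    and M: "0 \<le> M" "1 \<le> R" "2 * M \<le> R"
  defines "N \<equiv> real (total_delay d n + n)"
  shows "(\<Sum>t=1..n. l t (A t)) - (\<Sum>t=1..n. l t k)
    \<le> (\<Sum>t=1..n. excess k A t) + 38 * (sqrt (real K) * sqrt (3 + N) * sqrt (ln (3 + N))) * R"
proof -
  define G where "G = sqrt (3 + N) * sqrt (ln (3 + N))"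
  have N0: "0 \<le> N" by (simp add: N_def)
  have sK: "1 \<le> sqrt (real K)" using K by simp
  have lM: "\<And>s. s \<in> {1..n} \<Longrightarrow> l s (A s) \<le> M" using A l by blast
  let ?lin = "\<lambda>t. \<Sum>i=1..K. loss_est l d A t (play_dist K l d A t) i * (play_dist K l d A t i - vertex k i)"
  let ?skip = "\<lambda>t. if Lhat l d A t < l t (A t) then l t (A t) else 0"
  have "(\<Sum>t=1..n. excess k A t) = (\<Sum>t=1..n. l t (A t)) - (\<Sum>t=1..n. l t k) - (\<Sum>t=1..n. ?lin t)
      - (\<Sum>t=1..n. ?skip t) + (\<Sum>t=1..n. stability K l d A t) - sqrt (real K) * (\<Sum>t=1..n. (Lhat l d A t)\<^sup>2 / sigma l d A t)"
    unfolding excess_def sum_distrib_left by (simp only: sum.distrib sum_subtractf)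
  moreover have "(\<Sum>t=1..n. ?lin t) \<le> (\<Sum>t=1..n. invest l d A t) * (2 * sqrt (real K)) + (\<Sum>t=1..n. stability K l d A t)"
    using A l by (intro linearized_regret_le[OF K k]) auto
  moreover have "(\<Sum>t=1..n. invest l d A t) * (2 * sqrt (real K)) \<le> (16 * G * R) * (2 * sqrt (real K))"
    unfolding G_def N_def
    by (intro mult_right_mono sum_invest_bound[where l = l and A = A and M = M, OF lM M]) auto
  moreover have "(\<Sum>t=1..n. ?skip t) \<le> sqrt (real K) * (4 * G * R)"
  proof -
    have "(\<Sum>t=1..n. ?skip t) = (\<Sum>s\<in>{s \<in> {1..n}. Lhat l d A s < l s (A s)}. l s (A s))"
      by (rule sum.inter_filter[symmetric]) simp
    also have "\<dots> \<le> 2 * sqrt (2 * N) * M"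
      unfolding N_def by (rule sum_loss_skipped_le[where l = l and A = A and M = M, OF lM M(1)])
    also have "\<dots> \<le> 2 * (2 * G) * R"
    proof (intro mult_mono mult_left_mono)
      have "sqrt (2 * N) \<le> sqrt (4 * (3 + N))" using N0 by (intro real_sqrt_le_mono) auto
      also have "\<dots> = 2 * sqrt (3 + N)" by (simp only: real_sqrt_mult real_sqrt_four)
      finally have "sqrt (2 * N) \<le> 2 * sqrt (3 + N)" .
      moreover have "sqrt (3 + N) * 1 \<le> G" unfolding G_def
      proof (intro mult_left_mono)
        \<comment> \<open>The shift by 3, being at least \<open>exp 1\<close>, makes the logarithm
          at least 1, so the skipped losses fit under the same rate.\<close>
        have "exp 1 \<le> 3 + N" using exp_le N0 by linarith
        then show "1 \<le> sqrt (ln (3 + N))" using N0 by (simp add: ln_ge_iff)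
      qed (use N0 in auto)
      ultimately show "sqrt (2 * N) \<le> 2 * G" by simp
      show "M \<le> R" using M by linarith
    qed (use N0 M G_def in auto)
    also have "\<dots> = 1 * (4 * G * R)" by simp
    also have "\<dots> \<le> sqrt (real K) * (4 * G * R)"
      using sK N0 M by (intro mult_right_mono) (auto simp: G_def)
    finally show ?thesis .
  qed
  moreover have "sqrt (real K) * (\<Sum>t=1..n. (Lhat l d A t)\<^sup>2 / sigma l d A t) \<le> sqrt (real K) * (2 * G * R)"
  proof (intro mult_left_mono)
    have "Lhat l d A t \<le> R" if "t \<in> {1..n}" for t
      by (rule Lhat_le[OF M(2)]) (use lM M that in force)
    then show "(\<Sum>t=1..n. (Lhat l d A t)\<^sup>2 / sigma l d A t) \<le> 2 * G * R"
      unfolding G_def N_def using M by (intro sum_Lhat_div_sigma_le) auto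
  qed auto
  ultimately have "(\<Sum>t=1..n. l t (A t)) - (\<Sum>t=1..n. l t k)
      \<le> (\<Sum>t=1..n. excess k A t) + 16 * G * R * (2 * sqrt (real K)) + sqrt (real K) * (4 * G * R) + sqrt (real K) * (2 * G * R)"
    by linarith
  also have "\<dots> = (\<Sum>t=1..n. excess k A t) + 38 * (sqrt (real K) * G) * R" by simp
  finally show ?thesis by (simp only: G_def mult.assoc)
qed

lemma pseudo_regret_le:
  assumes l: "losses_in K n M l" and M: "0 \<le> M" "1 \<le> R" "2 * M \<le> R"
  defines "N \<equiv> real (total_delay d n + n)"
  shows "pseudo_regret K l d n \<le> 38 * (sqrt (real K) * sqrt (3 + N) * sqrt (ln (3 + N))) * R"
  unfolding pseudo_regret_def
proof (rule Max.boundedI)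
  let ?E = "measure_pmf.expectation (actions K l d n)"
  let ?B = "38 * (sqrt (real K) * sqrt (3 + N) * sqrt (ln (3 + N))) * R"
  fix r assume "r \<in> (\<lambda>k. ?E (\<lambda>A. (\<Sum>t=1..n. l t (A t)) - (\<Sum>t=1..n. l t k))) ` {1..K}"
  then obtain k where k: "k \<in> {1..K}" "r = ?E (\<lambda>A. (\<Sum>t=1..n. l t (A t)) - (\<Sum>t=1..n. l t k))" by auto
  have l': "0 \<le> l t i \<and> l t i \<le> M" if "t \<in> {1..n}" "i \<in> {1..K}" for t i
    using l that by (auto simp: losses_in_def)
  have "r \<le> ?E (\<lambda>A. (\<Sum>t=1..n. excess k A t) + ?B)"
    unfolding k(2)
  proof (rule integral_mono_AE[OF integrable_actions integrable_actions])
    show "AE A in measure_pmf (actions K l d n). (\<Sum>t=1..n. l t (A t)) - (\<Sum>t=1..n. l t k)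
        \<le> (\<Sum>t=1..n. excess k A t) + ?B"
      unfolding N_def by (intro AE_pmfI pathwise_regret_le[OF k(1) _ l' M]) (auto dest: set_actions)
  qed
  also have "\<dots> = ?E (\<lambda>A. \<Sum>t=1..n. excess k A t) + ?B"
    by (subst Bochner_Integration.integral_add[OF integrable_actions integrable_actions]) simp
  also have "\<dots> \<le> ?B" using expectation_sum_excess_le[OF k(1)] l' by simp
  finally show "r \<le> ?B" .
qed (use K in auto)

text \<open>The case \<open>L = 0\<close> is separate: no multiple of \<open>L\<close> can then
  dominate the initial range guess 1.\<close>

lemma pseudo_regret_zero_losses:
  assumes "losses_in K n 0 l"
  shows "pseudo_regret K l d n \<le> 0"
  unfolding pseudo_regret_def
proof (rule Max.boundedI)
  let ?E = "measure_pmf.expectation (actions K l d n)"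
  have l: "l t i = 0" if "t \<in> {1..n}" "i \<in> {1..K}" for t i
    using assms that by (force simp: losses_in_def)
  fix r assume "r \<in> (\<lambda>k. ?E (\<lambda>A. (\<Sum>t=1..n. l t (A t)) - (\<Sum>t=1..n. l t k))) ` {1..K}"
  then obtain k where k: "k \<in> {1..K}" "r = ?E (\<lambda>A. (\<Sum>t=1..n. l t (A t)) - (\<Sum>t=1..n. l t k))" by auto
  have "r \<le> ?E (\<lambda>A. 0)"
    unfolding k(2)
    by (rule integral_mono_AE[OF integrable_actions integrable_actions])
      (use k l in \<open>auto intro!: AE_pmfI sum_nonpos dest: set_actions simp: l\<close>)
  then show "r \<le> 0" by simp
qed (use K in auto)

end

section \<open>From the explicit bound to the asymptotic rate\<close>

lemma log_rate_le:
  fixes n :: real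
  assumes "2 \<le> n"
  shows "sqrt (3 + n) * sqrt (ln (3 + n)) \<le> 3 * sqrt (n * ln n)"
proof -
  \<comment> \<open>The cube turns the shifted logarithm into \<open>3 * ln n\<close>; together with
    \<open>3 + n \<le> 3 * n\<close> this gives 9 under the root.\<close>
  have "(3 + n) \<le> n ^ 3"
  proof -
    have "2 * 2 * n \<le> n * n * n" using assms by (intro mult_mono) auto
    then show ?thesis using assms unfolding power3_eq_cube by linarith
  qed
  then have "ln (3 + n) \<le> ln (n ^ 3)" using assms by (subst ln_le_cancel_iff) auto
  also have "\<dots> = 3 * ln n" using assms by (simp add: ln_realpow)
  finally have "(3 + n) * ln (3 + n) \<le> (3 * n) * (3 * ln n)"
    using assms by (intro mult_mono) auto
  then have "sqrt ((3 + n) * ln (3 + n)) \<le> sqrt (9 * (n * ln n))" by (intro real_sqrt_le_mono) (simp add: mult_ac)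
  then show ?thesis by (simp add: real_sqrt_mult)
qed

text \<open>With \<open>L \<ge> L0\<close>, the choice \<open>R = (2 + 1 / L0) * L\<close> dominates
  both 1 and \<open>2 * L\<close>, which makes the bound linear in \<open>L\<close>; the constant is
  \<open>114 = 38 * 3\<close>.\<close>

lemma pseudo_regret_bound:
  assumes "2 \<le> K" "2 \<le> total_delay d T + T" "0 < L0" "L0 \<le> L \<or> L = 0" "losses_in K T L l"
  shows "pseudo_regret K l d T \<le> 114 * (2 + 1 / L0) *
    (sqrt (real K * real (total_delay d T + T) * ln (real (total_delay d T + T))) * L)"
proof (cases "L = 0")
  case True
  then show ?thesis using pseudo_regret_zero_losses[of K T l d] assms by simp
next
  case False
  define n where "n = real (total_delay d T + T)"
  have n: "2 \<le> n" using assms(2) unfolding n_def by linarith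
  have L: "L0 \<le> L" "0 < L" using False assms by auto
  have R: "1 \<le> (2 + 1 / L0) * L" "2 * L \<le> (2 + 1 / L0) * L"
  proof -
    have "1 \<le> 1 / L0 * L" using L assms(3) by simp
    then show "1 \<le> (2 + 1 / L0) * L" "2 * L \<le> (2 + 1 / L0) * L"
      using L by (simp_all add: distrib_right)
  qed
  have "pseudo_regret K l d T \<le> 38 * (sqrt (real K) * sqrt (3 + n) * sqrt (ln (3 + n))) * ((2 + 1 / L0) * L)"
    unfolding n_def using assms L R by (intro pseudo_regret_le[of K T L l]) auto
  also have "\<dots> = 38 * sqrt (real K) * (sqrt (3 + n) * sqrt (ln (3 + n))) * ((2 + 1 / L0) * L)"
    by (simp only: mult.assoc)
  also have "\<dots> \<le> 38 * sqrt (real K) * (3 * sqrt (n * ln n)) * ((2 + 1 / L0) * L)"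
    using log_rate_le[OF n] R by (intro mult_right_mono mult_left_mono) auto
  also have "\<dots> = 114 * (2 + 1 / L0) * (sqrt (real K * n * ln n) * L)"
    by (simp add: real_sqrt_mult mult_ac)
  finally show ?thesis by (simp add: n_def)
qed

lemma sqrt_le_self_over_sqrt_ln2:
  assumes "2 \<le> (n :: real)"
  shows "sqrt (ln n) \<le> 1 / sqrt (ln 2) * ln n"
proof -
  have "sqrt (ln 2) * sqrt (ln n) \<le> sqrt (ln n) * sqrt (ln n)"
    using assms by (intro mult_right_mono) auto
  then show ?thesis using assms by (simp add: field_simps)
qed

theorem theorem6p1:
  shows "(\<forall>L0>0. \<exists>C>0. \<forall>K T l d L.
      2 \<le> K \<longrightarrow> 1 \<le> T \<longrightarrow> 2 \<le> total_delay d T + T \<longrightarrow>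
      (L0 \<le> L \<or> L = 0) \<longrightarrow> losses_in K T L l \<longrightarrow>
      pseudo_regret K l d T \<le> C * (sqrt (real K * real (total_delay d T + T) * ln (real (total_delay d T + T))) * L))
    \<and> (\<exists>p::nat. (\<forall>L0>0. \<exists>C>0. \<forall>K T l d L.
      2 \<le> K \<longrightarrow> 1 \<le> T \<longrightarrow> 2 \<le> total_delay d T + T \<longrightarrow>
      (L0 \<le> L \<or> L = 0) \<longrightarrow> losses_in K T L l \<longrightarrow>
      pseudo_regret K l d T \<le> C * (sqrt (real K * real (total_delay d T + T)) * L * ln (real (total_delay d T + T)) ^ p)))"
\<comment> \<open>The exponent 1 suffices for the second form: \<open>sqrt (ln n)\<close> is at most
  \<open>ln n / sqrt (ln 2)\<close> for \<open>n \<ge> 2\<close>, and the constant absorbs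
  \<open>1 / sqrt (ln 2)\<close>.\<close>
proof (intro conjI exI[of _ "1 :: nat"] allI impI)
  fix L0 :: real assume L0: "0 < L0"
  define C where "C = 114 * (2 + 1 / L0)"
  have C: "0 < C" using L0 by (simp add: C_def add_pos_pos)
  show "\<exists>C>0. \<forall>K T l d L.
      2 \<le> K \<longrightarrow> 1 \<le> T \<longrightarrow> 2 \<le> total_delay d T + T \<longrightarrow>
      (L0 \<le> L \<or> L = 0) \<longrightarrow> losses_in K T L l \<longrightarrow>
      pseudo_regret K l d T \<le> C * (sqrt (real K * real (total_delay d T + T) * ln (real (total_delay d T + T))) * L)"
    using C pseudo_regret_bound[OF _ _ L0] unfolding C_def by blast
  show "\<exists>C>0. \<forall>K T l d L.
      2 \<le> K \<longrightarrow> 1 \<le> T \<longrightarrow> 2 \<le> total_delay d T + T \<longrightarrow>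
      (L0 \<le> L \<or> L = 0) \<longrightarrow> losses_in K T L l \<longrightarrow>
      pseudo_regret K l d T \<le> C * (sqrt (real K * real (total_delay d T + T)) * L * ln (real (total_delay d T + T)) ^ 1)"
  proof (intro exI[of _ "C * (1 / sqrt (ln 2))"] conjI allI impI)
    show "0 < C * (1 / sqrt (ln 2))" using C by simp
    fix K T l d L
    assume *: "2 \<le> K" "1 \<le> T" "2 \<le> total_delay d T + T" "L0 \<le> L \<or> L = 0" "losses_in K T L l"
    let ?n = "real (total_delay d T + T)"
    have n: "2 \<le> ?n" using *(3) by linarith
    have L: "0 \<le> L" using *(4) L0 by auto
    have "pseudo_regret K l d T \<le> C * (sqrt (real K * ?n * ln ?n) * L)"
      unfolding C_def by (rule pseudo_regret_bound[OF *(1,3) L0 *(4,5)])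
    also have "\<dots> = C * (sqrt (real K * ?n) * L) * sqrt (ln ?n)"
      by (simp add: real_sqrt_mult mult_ac)
    also have "\<dots> \<le> C * (sqrt (real K * ?n) * L) * (1 / sqrt (ln 2) * ln ?n)"
      using sqrt_le_self_over_sqrt_ln2[OF n] C L by (intro mult_left_mono) auto
    finally show "pseudo_regret K l d T \<le> C * (1 / sqrt (ln 2)) * (sqrt (real K * ?n) * L * ln ?n ^ 1)"
      by (simp add: mult_ac)
  qed
qed

end
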